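(* Let $G$ be a regular graph on $n$ vertices. Consider any persistent (dissipative) particle system on $G$, with $n$ particles initially, where all types have the same speed, and the starting locations of particles are independent and stationary (i.e. uniformly distributed on $V(G)$). Then there is a constant $\delta>0$, depending only on the particle system, such that with high probability any type of positive initial density has not yet been eliminated after $\delta n\log n$ steps.
   Context: Particle system: there is a finite set of types. Each type has a speed, the speeds summing to $1$, and for each pair of types $(A,B)$ there is a probability distribution $\pi_{AB}=\pi_{BA}$ on finite multisets of types ("outputs"). Types, speeds and the $\pi_{AB}$ are fixed independently of $n$. Particles, each having a type, are located at vertices of $G$ (several may share a vertex). In each step one particle is selected with probability proportional to its speed among all current particles (so uniformly at random if all speeds are equal), and takes a simple random walk step. On arriving at a vertex with other particles present, it meets each of them in a random order until either an effective reaction occurs or all reactions are ineffective. When a particle of type $A$ meets one of type $B$, both are removed and a new particle of each type in $S\sim\pi_{AB}$ (sampled independently of all other randomness) is added at that vertex; the reaction is effective if the output differs from the input $\{A,B\}$, and ineffective otherwise (the two particles simply remain). Dissipative: each type can be assigned an energy (a positive real) such that every effective reaction that can occur strictly decreases the total energy of all particles. The initial number of particles of each type is fixed in advance; the density of a type is its number of particles divided by $n$, and positive initial density means that this is at least some positive constant independent of $n$. For given reactions and initial densities, the particle system is persistent if there is $\varepsilon>0$ (independent of $n$) such that the total density of particles must remain at least $\varepsilon$ throughout any possible sequence of reactions in a mean-field setting, i.e. where any two particles are allowed to meet at each step, ignoring $G$. A type is eliminated when no particle of that type remains. "With high probability" means with probability tending to $1$ as $n\to\infty$. *)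

theory Defs
  imports
    "HOL-Probability.Probability"
    "HOL-Combinatorics.Multiset_Permutations"
    "Graph_Theory.Pair_Digraph"
begin

section \<open>Particle systems\<close>

text \<open>
  The finite set of types is the type \<open>'t\<close>. The output distributions are \<open>pmf\<close>s on
  \<open>'t multiset\<close>. The initial number of particles of type \<open>A\<close> on an \<open>n\<close>-vertex graph is
  \<open>k n A\<close>; this is the only part of a particle system that may depend on \<open>n\<close>.
\<close>

definition particle_system ::
    "('t::finite \<Rightarrow> real) \<Rightarrow> ('t \<Rightarrow> 't \<Rightarrow> 't multiset pmf) \<Rightarrow> bool" where
  "particle_system speed react \<longleftrightarrow>
     (\<forall>A. 0 \<le> speed A) \<and> (\<Sum>A\<in>UNIV. speed A) = 1 \<and> (\<forall>A B. react A B = react B A)"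

text \<open>The reactions that can occur between \<open>A\<close> and \<open>B\<close> are those of positive probability.\<close>

definition dissipative :: "('t \<Rightarrow> 't \<Rightarrow> 't multiset pmf) \<Rightarrow> bool" where
  "dissipative react \<longleftrightarrow>
     (\<exists>energy :: 't \<Rightarrow> real. (\<forall>A. 0 < energy A) \<and>
       (\<forall>A B. \<forall>S \<in> set_pmf (react A B). S \<noteq> {#A, B#} \<longrightarrow>
          (\<Sum>C\<in>#S. energy C) < energy A + energy B))"

inductive mean_field_step ::
    "('t \<Rightarrow> 't \<Rightarrow> 't multiset pmf) \<Rightarrow> 't multiset \<Rightarrow> 't multiset \<Rightarrow> bool"
  for react where
  "S \<in> set_pmf (react A B) \<Longrightarrow> mean_field_step react (M + {#A, B#}) (M + S)"

text \<open>
  As the density bounds only matter as \<open>n\<close> tends to infinity, they are required for all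
  sufficiently large \<open>n\<close>; rounding could make them fail for small \<open>n\<close>.
\<close>

definition persistent ::
    "('t::finite \<Rightarrow> 't \<Rightarrow> 't multiset pmf) \<Rightarrow> (nat \<Rightarrow> 't \<Rightarrow> nat) \<Rightarrow> bool" where
  "persistent react k \<longleftrightarrow>
     (\<exists>\<epsilon>>0. \<forall>\<^sub>F n in sequentially. \<forall>M.
        (mean_field_step react)\<^sup>*\<^sup>* (\<Sum>A\<in>UNIV. replicate_mset (k n A) A) M \<longrightarrow>
        real (size M) / real n \<ge> \<epsilon>)"

definition positive_initial_density :: "(nat \<Rightarrow> 't \<Rightarrow> nat) \<Rightarrow> 't \<Rightarrow> bool" where
  "positive_initial_density k A \<longleftrightarrow>
     (\<exists>c>0. \<forall>\<^sub>F n in sequentially. real (k n A) / real n \<ge> c)"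

section \<open>Regular graphs\<close>

definition neighbours :: "'v pair_pre_digraph \<Rightarrow> 'v \<Rightarrow> 'v set" where
  "neighbours G v = {w. (v, w) \<in> parcs G}"

text \<open>\<open>pair_graph\<close>: finite, symmetric, loop-free, without parallel edges.\<close>

definition regular_graph :: "'v pair_pre_digraph \<Rightarrow> bool" where
  "regular_graph G \<longleftrightarrow>
     pair_graph G \<and> (\<exists>d. \<forall>v\<in>pverts G. card (neighbours G v) = d)"

section \<open>The process on a graph\<close>

text \<open>A configuration is the multiset of all current particles, each given by location and type.\<close>

type_synonym ('v, 't) config = "('v \<times> 't) multiset"

definition total_speed :: "('t \<Rightarrow> real) \<Rightarrow> ('v, 't) config \<Rightarrow> real" where
  "total_speed speed c = (\<Sum>p\<in>#c. speed (snd p))"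

text \<open>Meaningful only for nonnegative speeds with \<open>total_speed speed c > 0\<close>,
  see \<open>pmf_select_particle\<close> below.\<close>

definition select_particle :: "('t \<Rightarrow> real) \<Rightarrow> ('v, 't) config \<Rightarrow> ('v \<times> 't) pmf" where
  "select_particle speed c =
     embed_pmf (\<lambda>p. real (count c p) * speed (snd p) / total_speed speed c)"

lemma total_speed_alt:
  "total_speed speed c = (\<Sum>p\<in>set_mset c. real (count c p) * speed (snd p))"
proof -
  have "(\<Sum>p\<in>#c. speed (snd p)) = (\<Sum>p\<in>S. real (count c p) * speed (snd p))"
    if "finite S" "set_mset c \<subseteq> S" for S
    using that(2)
  proof (induction c)
    case empty
    then show ?case by simp
  next
    case (add q c)
    have "(\<Sum>p\<in>S. real (count (add_mset q c) p) * speed (snd p)) =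
          (\<Sum>p\<in>S. (if p = q then speed (snd p) else 0) + real (count c p) * speed (snd p))"
      by (intro sum.cong) (auto simp: algebra_simps)
    also have "\<dots> = speed (snd q) + (\<Sum>p\<in>S. real (count c p) * speed (snd p))"
      using that(1) add.prems by (simp add: sum.distrib)
    finally show ?case using add by simp
  qed
  then show ?thesis by (simp add: total_speed_def)
qed

lemma pmf_select_particle:
  assumes nonneg: "\<And>A. 0 \<le> speed A" and pos: "0 < total_speed speed c"
  shows "pmf (select_particle speed c) p =
           real (count c p) * speed (snd p) / total_speed speed c"
proof -
  let ?f = "\<lambda>p. real (count c p) * speed (snd p) / total_speed speed c"
  have f: "0 \<le> ?f p" for p
    using nonneg pos by simp
  have "(\<integral>\<^sup>+ p. ennreal (?f p) \<partial>count_space UNIV) = (\<Sum>p\<in>set_mset c. ennreal (?f p))"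
    by (rule nn_integral_count_space') (auto simp: not_in_iff)
  also have "\<dots> = ennreal (\<Sum>p\<in>set_mset c. ?f p)"
    using f by (intro sum_ennreal) auto
  also have "(\<Sum>p\<in>set_mset c. ?f p) = 1"
    using pos by (simp add: total_speed_alt flip: sum_divide_distrib)
  finally show ?thesis
    unfolding select_particle_def using f by (subst pmf_embed_pmf) auto
qed

text \<open>
  \<open>meet react A Bs\<close>: a particle of type \<open>A\<close> meets the particles in the list \<open>Bs\<close> in turn, until
  an effective reaction occurs. The result is the multiset of all types present afterwards.
\<close>

primrec meet :: "('t \<Rightarrow> 't \<Rightarrow> 't multiset pmf) \<Rightarrow> 't \<Rightarrow> 't list \<Rightarrow> 't multiset pmf" where
  "meet react A [] = return_pmf {#A#}"
| "meet react A (B # Bs) =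
     bind_pmf (react A B) (\<lambda>S.
       if S = {#A, B#} then map_pmf (add_mset B) (meet react A Bs)
       else return_pmf (S + mset Bs))"

text \<open>
  The selected particle arrives at \<open>w\<close>; \<open>c\<close> consists of all other particles. A uniformly random
  order of the particles at \<open>w\<close> induces a uniformly random element of \<open>permutations_of_multiset\<close>
  of their types.
\<close>

definition arrive ::
    "('t \<Rightarrow> 't \<Rightarrow> 't multiset pmf) \<Rightarrow> ('v, 't) config \<Rightarrow> 't \<Rightarrow> 'v \<Rightarrow> ('v, 't) config pmf" where
  "arrive react c A w =
     (let here = {#p \<in># c. fst p = w#}; elsewhere = {#p \<in># c. fst p \<noteq> w#} in
      bind_pmf (pmf_of_set (permutations_of_multiset (image_mset snd here))) (\<lambda>Bs.
        map_pmf (\<lambda>S. elsewhere + image_mset (Pair w) S) (meet react A Bs)))"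

text \<open>
  Conventions where no random walk step exists: the configuration does not change if no particle
  of positive speed remains, or if the selected particle is at an isolated vertex.
\<close>

definition system_step ::
    "'v pair_pre_digraph \<Rightarrow> ('t \<Rightarrow> real) \<Rightarrow> ('t \<Rightarrow> 't \<Rightarrow> 't multiset pmf) \<Rightarrow>
     ('v, 't) config \<Rightarrow> ('v, 't) config pmf" where
  "system_step G speed react c =
     (if total_speed speed c = 0 then return_pmf c
      else bind_pmf (select_particle speed c) (\<lambda>(v, A).
        if neighbours G v = {} then return_pmf c
        else bind_pmf (pmf_of_set (neighbours G v)) (arrive react (c - {#(v, A)#}) A)))"

text \<open>The list of configurations at times \<open>0, \<dots>, T\<close>, started from \<open>c\<close>.\<close>

primrec trajectory ::
    "'v pair_pre_digraph \<Rightarrow> ('t \<Rightarrow> real) \<Rightarrow> ('t \<Rightarrow> 't \<Rightarrow> 't multiset pmf) \<Rightarrow>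
     nat \<Rightarrow> ('v, 't) config \<Rightarrow> ('v, 't) config list pmf" where
  "trajectory G speed react 0 c = return_pmf [c]"
| "trajectory G speed react (Suc T) c =
     bind_pmf (system_step G speed react c)
       (\<lambda>c'. map_pmf ((#) c) (trajectory G speed react T c'))"

text \<open>
  The particles are labelled \<open>(A, i)\<close> with \<open>i < m A\<close>; their locations are independent and uniform.
  (On a regular graph the uniform distribution is stationary.)
\<close>

definition uniform_start :: "'v set \<Rightarrow> ('t::finite \<Rightarrow> nat) \<Rightarrow> ('v, 't) config pmf" where
  "uniform_start V m =
     (let P = (SIGMA A:UNIV. {..<m A}) in
      map_pmf (\<lambda>loc. image_mset (\<lambda>p. (loc p, fst p)) (mset_set P))
        (Pi_pmf P undefined (\<lambda>_. pmf_of_set V)))"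

definition run_system ::
    "'v pair_pre_digraph \<Rightarrow> ('t::finite \<Rightarrow> real) \<Rightarrow> ('t \<Rightarrow> 't \<Rightarrow> 't multiset pmf) \<Rightarrow>
     ('t \<Rightarrow> nat) \<Rightarrow> nat \<Rightarrow> ('v, 't) config list pmf" where
  "run_system G speed react m T =
     bind_pmf (uniform_start (pverts G) m) (trajectory G speed react T)"

text \<open>No configuration up to the last recorded time is without particles of type \<open>A\<close>.\<close>

definition not_yet_eliminated :: "'t \<Rightarrow> ('v, 't) config list \<Rightarrow> bool" where
  "not_yet_eliminated A cs \<longleftrightarrow> (\<forall>c\<in>set cs. A \<in># image_mset snd c)"

end

theory Submission
  imports Defs "HOL-Real_Asymp.Real_Asymp"
begin

text \<open>
  Scale the energies to be at least \<open>1\<close>. For a vertex \<open>v\<close> holding a single particle of type \<open>A\<close>,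
  take the product of \<open>(1 - l) ^ m\<close>, bounding the probability that it is not selected in the next
  \<open>m\<close> lazy steps, and, over all other particles, the probability that a lazy walk from there avoids \<open>v\<close> for \<open>m\<close>
  steps, raised to the energy of the particle. This does not decrease in conditional expectation:
  for moves by Bernoulli's inequality, for reactions because they lose energy. Summed over \<open>v\<close>,
  this gives a submartingale \<open>Z\<close>, positive only if \<open>A\<close> is present, with expectation of order
  \<open>n powr (3 / 4)\<close> at the start if \<open>\<delta>\<close> is small. One step affects only \<open>O(1)\<close> particles,
  and a walk is expected to hit only \<open>O(log n)\<close> vertices, so each increment of \<open>Z\<close> is \<open>O(log n)\<close>;
  hence a second moment bound over \<open>O(n log n)\<close> steps shows that \<open>Z\<close> stays positive with
  high probability. Persistence enters only in bounding the rate at which a particle moves.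
\<close>

section \<open>Expectations\<close>

lemma integrable_pmf_bounded:
  fixes f :: "'a \<Rightarrow> real"
  assumes "\<And>x. x \<in> set_pmf p \<Longrightarrow> \<bar>f x\<bar> \<le> B"
  shows "integrable (measure_pmf p) f"
  using assms by (intro measure_pmf.integrable_const_bound[where B = B]) (auto simp: AE_measure_pmf_iff)

lemma expectation_mono_pmf:
  fixes f g :: "'a \<Rightarrow> real"
  assumes "\<And>x. x \<in> set_pmf p \<Longrightarrow> \<bar>f x\<bar> \<le> B" "\<And>x. x \<in> set_pmf p \<Longrightarrow> \<bar>g x\<bar> \<le> C"
    and "\<And>x. x \<in> set_pmf p \<Longrightarrow> f x \<le> g x"
  shows "measure_pmf.expectation p f \<le> measure_pmf.expectation p g"
  using assms by (intro integral_mono_AE integrable_pmf_bounded) (auto simp: AE_measure_pmf_iff)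

lemma expectation_ge_pmf:
  fixes f :: "'a \<Rightarrow> real"
  assumes "\<And>x. x \<in> set_pmf p \<Longrightarrow> \<bar>f x\<bar> \<le> B" "\<And>x. x \<in> set_pmf p \<Longrightarrow> a \<le> f x"
  shows "a \<le> measure_pmf.expectation p f"
  using expectation_mono_pmf[of p "\<lambda>_. a" "\<bar>a\<bar>" f B] assms by simp

lemma expectation_le_pmf:
  fixes f :: "'a \<Rightarrow> real"
  assumes "\<And>x. x \<in> set_pmf p \<Longrightarrow> \<bar>f x\<bar> \<le> B" "\<And>x. x \<in> set_pmf p \<Longrightarrow> f x \<le> a"
  shows "measure_pmf.expectation p f \<le> a"
  using expectation_mono_pmf[of p f B "\<lambda>_. a" "\<bar>a\<bar>"] assms by simp

lemma expectation_abs_le_pmf: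
  fixes f :: "'a \<Rightarrow> real"
  assumes "\<And>x. x \<in> set_pmf p \<Longrightarrow> \<bar>f x\<bar> \<le> B"
  shows "\<bar>measure_pmf.expectation p f\<bar> \<le> B"
  using expectation_le_pmf[of p f B B] expectation_ge_pmf[of p f B "- B"] assms
  by (smt (verit))

lemma expectation_bind_pmf_bounded:
  fixes f :: "'b \<Rightarrow> real"
  assumes "\<And>x. \<bar>f x\<bar> \<le> B"
  shows "measure_pmf.expectation (bind_pmf p g) f =
         measure_pmf.expectation p (\<lambda>x. measure_pmf.expectation (g x) f)"
  unfolding measure_pmf_bind
  by (rule integral_bind[where K = "count_space UNIV" and B' = 1 and B = B])
    (use assms in \<open>auto simp: measurable_def space_subprob_algebra measure_pmf.finite_measure_axioms
   measure_pmf.emeasure_space_1 intro: prob_space_imp_subprob_space measure_pmf.prob_space_axioms\<close>)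

lemma prob_bind_pmf:
  "measure_pmf.prob (bind_pmf p g) X = measure_pmf.expectation p (\<lambda>x. measure_pmf.prob (g x) X)"
  using expectation_bind_pmf_bounded[of "indicator X" 1 p g] by (simp add: indicator_def)

text \<open>With \<open>s\<close> the shortfall of \<open>z\<close> below \<open>\<theta>\<close>,
  \<open>\<theta> - Y\<close> is at most \<open>s + (\<mu> - Y)\<close>, whose second moment is
  \<open>s^2\<close> plus the variance of \<open>Y\<close>. The variance is at most the mean square
  distance to any fixed \<open>z0\<close>.\<close>

lemma expectation_pos_part_square_le:
  fixes Y :: "'a \<Rightarrow> real"
  assumes Y: "\<And>x. x \<in> set_pmf p \<Longrightarrow> \<bar>Y x - z0\<bar> \<le> b"
    and z: "z \<le> measure_pmf.expectation p Y"
  shows "measure_pmf.expectation p (\<lambda>x. (max 0 (\<theta> - Y x))\<^sup>2) \<le> (max 0 (\<theta> - z))\<^sup>2 + b\<^sup>2"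
proof -
  define \<mu> where "\<mu> = measure_pmf.expectation p Y"
  define s where "s = max 0 (\<theta> - z)"
  \<comment> \<open>\<open>C + D * Y\<close> is what remains of the expanded square once
    \<open>(Y - z0)^2\<close> is replaced by \<open>b^2\<close>; being affine, it needs only the
    mean of \<open>Y\<close>.\<close>
  define C where "C = s\<^sup>2 + b\<^sup>2 + (\<mu> - z0)\<^sup>2 + 2 * s * \<mu> + 2 * (\<mu> - z0) * z0"
  define D where "D = - 2 * s - 2 * (\<mu> - z0)"
  have bound: "\<bar>Y x\<bar> \<le> \<bar>z0\<bar> + b" if "x \<in> set_pmf p" for x
    using Y[OF that] by linarith
  have int: "integrable (measure_pmf p) Y"
    by (rule integrable_pmf_bounded[OF bound])
  have le: "(max 0 (\<theta> - Y x))\<^sup>2 \<le> C + D * Y x" if x: "x \<in> set_pmf p" for x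
  proof -
    have "(max 0 (\<theta> - Y x))\<^sup>2 \<le> (s + \<mu> - Y x)\<^sup>2"
    proof (cases "\<theta> - Y x \<le> 0")
      case False
      then show ?thesis using z by (intro power_mono) (auto simp: s_def \<mu>_def max_def)
    qed (simp add: max_def)
    also have "\<dots> = s\<^sup>2 + 2 * s * (\<mu> - Y x) + (Y x - z0)\<^sup>2 - 2 * (\<mu> - z0) * (Y x - z0) + (\<mu> - z0)\<^sup>2"
      by (simp add: power2_eq_square algebra_simps)
    also have "(Y x - z0)\<^sup>2 \<le> b\<^sup>2"
      using Y[OF x] by (metis abs_ge_zero power2_abs power_mono)
    finally show ?thesis by (simp add: C_def D_def algebra_simps)
  qed
  have "(max 0 (\<theta> - Y x))\<^sup>2 \<le> (\<bar>\<theta>\<bar> + (\<bar>z0\<bar> + b))\<^sup>2" if "x \<in> set_pmf p" for x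
    using bound[OF that] by (intro power_mono) auto
  then have int2: "integrable (measure_pmf p) (\<lambda>x. (max 0 (\<theta> - Y x))\<^sup>2)"
    by (intro integrable_pmf_bounded[where B = "(\<bar>\<theta>\<bar> + (\<bar>z0\<bar> + b))\<^sup>2"]) auto
  have "measure_pmf.expectation p (\<lambda>x. (max 0 (\<theta> - Y x))\<^sup>2) \<le> measure_pmf.expectation p (\<lambda>x. C + D * Y x)"
    using le int int2 by (intro integral_mono_AE) (auto simp: AE_measure_pmf_iff)
  also have "\<dots> = C + D * \<mu>"
    using int by (simp add: \<mu>_def)
  also have "\<dots> = s\<^sup>2 + b\<^sup>2 - (\<mu> - z0)\<^sup>2"
    by (simp add: C_def D_def power2_eq_square algebra_simps)
  finally show ?thesis
    unfolding s_def by (smt (verit) zero_le_power2)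
qed

text \<open>Exposing the coordinates one at a time gives an Efron--Stein bound for the lower tail.\<close>

lemma Pi_pmf_pos_part_square_le:
  fixes f :: "('a \<Rightarrow> 'b) \<Rightarrow> real"
  assumes "finite P" and "\<And>x. \<bar>f x\<bar> \<le> B"
    and "\<And>x i y y'. \<bar>f (x(i := y)) - f (x(i := y'))\<bar> \<le> b"
  shows "measure_pmf.expectation (Pi_pmf P d p) (\<lambda>x. (max 0 (\<theta> - f x))\<^sup>2) \<le>
         (max 0 (\<theta> - measure_pmf.expectation (Pi_pmf P d p) f))\<^sup>2 + real (card P) * b\<^sup>2"
  using assms
proof (induction P arbitrary: f rule: finite_induct)
  case empty
  then show ?case by simp
next
  case (insert i P)
  \<comment> \<open>\<open>?g\<close> averages out coordinate \<open>i\<close> and inherits both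
    bounds on \<open>f\<close>, so the induction hypothesis applies to it; the exposed coordinate
    adds one \<open>b^2\<close>.\<close>
  let ?g = "\<lambda>x. measure_pmf.expectation (p i) (\<lambda>y. f (x(i := y)))"
  have pi: "Pi_pmf (insert i P) d p =
      bind_pmf (Pi_pmf P d p) (\<lambda>x. map_pmf (\<lambda>y. x(i := y)) (p i))"
    using insert.hyps by (subst Pi_pmf_insert'; simp add: map_pmf_def) (subst bind_commute_pmf, rule refl)
  have sq: "\<bar>(max 0 (\<theta> - f x))\<^sup>2\<bar> \<le> (\<bar>\<theta>\<bar> + B)\<^sup>2" for x
    using insert.prems(1)[of x] by (simp add: max_def abs_le_iff) (auto intro!: power_mono)
  have exp: "measure_pmf.expectation (Pi_pmf (insert i P) d p) h =
      measure_pmf.expectation (Pi_pmf P d p) (\<lambda>x. measure_pmf.expectation (p i) (\<lambda>y. h (x(i := y))))"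
    if "\<And>x. \<bar>h x\<bar> \<le> C" for h :: "('a \<Rightarrow> 'b) \<Rightarrow> real" and C
    unfolding pi by (subst expectation_bind_pmf_bounded[OF that]) simp
  have g_bdd: "\<bar>?g x\<bar> \<le> B" for x
    by (rule expectation_abs_le_pmf) (rule insert.prems(1))
  have sqg: "\<bar>(max 0 (\<theta> - ?g x))\<^sup>2\<bar> \<le> (\<bar>\<theta>\<bar> + B)\<^sup>2" for x
    using g_bdd[of x] by (simp add: max_def abs_le_iff) (auto intro!: power_mono)
  have g_lip: "\<bar>?g (x(j := y)) - ?g (x(j := y'))\<bar> \<le> b" for x j y y'
  proof (cases "j = i")
    case True
    \<comment> \<open>\<open>?g\<close> ignores coordinate \<open>i\<close>, so the difference is 0;
      the instance with \<open>y\<close> twice yields \<open>0 \<le> b\<close>.\<close>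
    then show ?thesis using insert.prems(2)[of x i y y] by simp
  next
    case False
    have "?g (x(j := y)) - ?g (x(j := y')) =
        measure_pmf.expectation (p i) (\<lambda>w. f (x(j := y, i := w)) - f (x(j := y', i := w)))"
      by (rule Bochner_Integration.integral_diff[symmetric])
        (rule integrable_pmf_bounded, rule insert.prems(1))+
    also have "\<bar>\<dots>\<bar> \<le> b"
      by (intro expectation_abs_le_pmf, subst (1 2) fun_upd_twist[OF False]) (rule insert.prems(2))
    finally show ?thesis .
  qed
  have "measure_pmf.expectation (Pi_pmf (insert i P) d p) (\<lambda>x. (max 0 (\<theta> - f x))\<^sup>2) =
     measure_pmf.expectation (Pi_pmf P d p)
       (\<lambda>x. measure_pmf.expectation (p i) (\<lambda>y. (max 0 (\<theta> - f (x(i := y))))\<^sup>2))"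
    by (rule exp[OF sq])
  also have "\<dots> \<le> measure_pmf.expectation (Pi_pmf P d p) (\<lambda>x. (max 0 (\<theta> - ?g x))\<^sup>2 + b\<^sup>2)"
  proof (rule expectation_mono_pmf)
    \<comment> \<open>Values of \<open>f\<close> along coordinate \<open>i\<close> differ by at most
      \<open>b\<close>, so any one of them can serve as the reference point
      \<open>z0\<close>.\<close>
    show "measure_pmf.expectation (p i) (\<lambda>y. (max 0 (\<theta> - f (x(i := y))))\<^sup>2) \<le> (max 0 (\<theta> - ?g x))\<^sup>2 + b\<^sup>2" for x
      by (rule expectation_pos_part_square_le[where ?z0.0 = "f (x(i := undefined))"])
        (rule insert.prems(2), rule order_refl)
    show "\<bar>measure_pmf.expectation (p i) (\<lambda>y. (max 0 (\<theta> - f (x(i := y))))\<^sup>2)\<bar> \<le> (\<bar>\<theta>\<bar> + B)\<^sup>2" for x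
      by (rule expectation_abs_le_pmf[OF sq])
    show "\<bar>(max 0 (\<theta> - ?g x))\<^sup>2 + b\<^sup>2\<bar> \<le> (\<bar>\<theta>\<bar> + B)\<^sup>2 + b\<^sup>2" for x
      using sqg[of x] by simp
  qed
  also have "\<dots> = measure_pmf.expectation (Pi_pmf P d p) (\<lambda>x. (max 0 (\<theta> - ?g x))\<^sup>2) + b\<^sup>2"
    by (subst Bochner_Integration.integral_add) (auto intro: integrable_pmf_bounded[OF sqg])
  also have "\<dots> \<le> (max 0 (\<theta> - measure_pmf.expectation (Pi_pmf P d p) ?g))\<^sup>2 + real (card P) * b\<^sup>2 + b\<^sup>2"
    using insert.IH[of ?g, OF g_bdd g_lip] by linarith
  also have "measure_pmf.expectation (Pi_pmf P d p) ?g = measure_pmf.expectation (Pi_pmf (insert i P) d p) f"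
    by (rule exp[symmetric, OF insert.prems(1)])
  finally show ?case
    using insert.hyps by (simp add: algebra_simps)
qed

section \<open>Elementary inequalities\<close>

text \<open>Convexity puts the graph of \<open>r powr a\<close> above its tangent at 1; this is
  Bernoulli's inequality for real exponents.\<close>

lemma powr_ge_tangent:
  fixes r a :: real
  assumes "0 \<le> r" "1 \<le> a"
  shows "1 + a * (r - 1) \<le> r powr a"
proof (cases "r = 0")
  case False
  have "a * (r - 1) \<le> r powr a - 1 powr a"
  proof (rule convex_on_imp_above_tangent[where A = "{0<..}"])
    show "((\<lambda>x. x powr a) has_real_derivative a) (at 1 within {0<..})"
      by (auto intro!: derivative_eq_intros)
  qed (use assms False in \<open>auto simp: powr_convex interior_open\<close>)
  then show ?thesis by simp
qed (use assms in auto)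

lemma exp_le_one_minus:
  fixes x :: real
  assumes "0 \<le> x" "x \<le> 1 / 2"
  shows "exp (- 2 * x) \<le> 1 - x"
proof -
  have "x * x \<le> x * (1 / 2)" using assms by (intro mult_left_mono)
  then have "- 2 * x \<le> ln (1 - x)"
    using ln_one_minus_pos_lower_bound[OF assms] by (simp add: power2_eq_square)
  then show ?thesis using assms by (subst (asm) ln_ge_iff) auto
qed

lemma prod_mset_01:
  fixes f :: "'a \<Rightarrow> real"
  assumes "\<And>x. x \<in># M \<Longrightarrow> 0 \<le> f x \<and> f x \<le> 1"
  shows "0 \<le> (\<Prod>x\<in>#M. f x) \<and> (\<Prod>x\<in>#M. f x) \<le> 1"
  using assms by (induction M) (auto intro: mult_le_one)

text \<open>The Weierstrass product inequality; in probabilistic terms, a union bound over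
  independent events.\<close>

lemma prod_mset_ge_one_minus_sum:
  fixes f :: "'a \<Rightarrow> real"
  assumes "\<And>x. x \<in># M \<Longrightarrow> 0 \<le> f x \<and> f x \<le> 1"
  shows "1 - (\<Sum>x\<in>#M. 1 - f x) \<le> (\<Prod>x\<in>#M. f x)"
  using assms
proof (induction M)
  case (add y M)
  let ?P = "\<Prod>x\<in>#M. f x"
  have "0 \<le> (1 - f y) * (1 - ?P)"
    using add.prems prod_mset_01[of M f] by (intro mult_nonneg_nonneg) auto
  then show ?case using add by (simp add: algebra_simps)
qed simp

section \<open>Hitting functions on a regular graph\<close>

text \<open>One step of simple random walk, which stays put at an isolated vertex just as particles
  do in \<open>system_step\<close>.\<close>

definition avg :: "'v pair_pre_digraph \<Rightarrow> ('v \<Rightarrow> real) \<Rightarrow> 'v \<Rightarrow> real" where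
  "avg G f x = (if neighbours G x = {} then f x
     else (\<Sum>y\<in>neighbours G x. f y) / real (card (neighbours G x)))"

text \<open>The probability that a lazy walk from \<open>x\<close>, which moves with probability \<open>l\<close> in
  each step, hits \<open>v\<close> within \<open>m\<close> steps.\<close>

primrec hit :: "'v pair_pre_digraph \<Rightarrow> real \<Rightarrow> 'v \<Rightarrow> nat \<Rightarrow> 'v \<Rightarrow> real" where
  "hit G l v 0 = (\<lambda>x. of_bool (x = v))"
| "hit G l v (Suc m) = (\<lambda>x. if x = v then 1 else (1 - l) * hit G l v m x + l * avg G (hit G l v m) x)"

locale lazy_walk =
  fixes G :: "'v pair_pre_digraph" and l :: real
  assumes reg: "regular_graph G" and l: "0 < l" "l \<le> 1"
begin

abbreviation "V \<equiv> pverts G"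

sublocale pair_graph G
  using reg by (simp add: regular_graph_def)

lemma finite_V: "finite V"
  by simp

lemma neighbours_V: "y \<in> neighbours G x \<Longrightarrow> x \<in> V \<and> y \<in> V"
  using in_arcsD1 in_arcsD2 by (auto simp: neighbours_def)

lemma neighbours_sym: "y \<in> neighbours G x \<longleftrightarrow> x \<in> neighbours G y"
  using arcs_symmetric by (auto simp: neighbours_def)

lemma finite_neighbours: "finite (neighbours G x)"
  using finite_V neighbours_V by (meson finite_subset subsetI)

lemma avg_mono: "(\<And>y. f y \<le> g y) \<Longrightarrow> avg G f x \<le> avg G g x"
  by (auto simp: avg_def intro!: divide_right_mono sum_mono)

lemma avg_const: "avg G (\<lambda>_. c) x = c"
  using finite_neighbours[of x] by (simp add: avg_def)

lemma avg_sum: "avg G (\<lambda>x. \<Sum>v\<in>A. f v x) x = (\<Sum>v\<in>A. avg G (f v) x)"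
  by (auto simp: avg_def sum_divide_distrib intro: sum.swap)

text \<open>Stationarity of the uniform distribution, by double counting of arcs: symmetry lets
  \<open>f y\<close> be counted once per neighbour of \<open>y\<close>, and equal degrees make these
  weights add up to 1.\<close>

lemma sum_avg: "(\<Sum>x\<in>V. avg G f x) = (\<Sum>x\<in>V. f x)"
proof -
  obtain d where d: "\<And>x. x \<in> V \<Longrightarrow> card (neighbours G x) = d"
    using reg by (auto simp: regular_graph_def)
  show ?thesis
  proof (cases "d = 0")
    case True
    then show ?thesis
      using d finite_neighbours by (intro sum.cong) (auto simp: avg_def)
  next
    case False
    have "(\<Sum>x\<in>V. avg G f x) = (\<Sum>x\<in>V. \<Sum>y\<in>neighbours G x. f y / d)"
      using d False by (intro sum.cong) (auto simp: avg_def sum_divide_distrib dest: d)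
    also have "\<dots> = (\<Sum>x\<in>V. \<Sum>y\<in>V. if y \<in> neighbours G x then f y / d else 0)"
      using neighbours_V finite_V by (intro sum.cong sum.mono_neutral_cong_left) auto
    also have "\<dots> = (\<Sum>y\<in>V. \<Sum>x\<in>V. if y \<in> neighbours G x then f y / d else 0)"
      by (rule sum.swap)
    also have "\<dots> = (\<Sum>y\<in>V. \<Sum>x\<in>neighbours G y. f y / d)"
      using neighbours_V finite_V neighbours_sym
      by (intro sum.cong sum.mono_neutral_cong_right) auto
    also have "\<dots> = (\<Sum>y\<in>V. f y)"
      using d False by (intro sum.cong) (auto simp del: card_0_eq)
    finally show ?thesis .
  qed
qed

lemma hit_01: "0 \<le> hit G l v m x \<and> hit G l v m x \<le> 1"
proof (induction m arbitrary: x)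
  case (Suc m)
  have "avg G (hit G l v m) x \<le> 1" "0 \<le> avg G (hit G l v m) x"
    using avg_mono[of "hit G l v m" "\<lambda>_. 1" x] avg_mono[of "\<lambda>_. 0" "hit G l v m" x] Suc avg_const
    by auto
  then show ?case
    using l Suc[of x] convex_bound_le[of "hit G l v m x" 1 "avg G (hit G l v m) x" "1 - l" l] by auto
qed auto

lemma hit_self [simp]: "hit G l v m v = 1"
  by (cases m) auto

text \<open>The recursion is monotone in the function it is applied to, so the inequality propagates
  from the initial indicator function.\<close>

lemma hit_Suc_mono: "hit G l v m x \<le> hit G l v (Suc m) x"
proof (induction m arbitrary: x)
  case 0
  then show ?case using hit_01[of v 1 x] by auto
next
  case (Suc m)
  have "hit G l v (Suc m) x \<le> (1 - l) * hit G l v (Suc m) x + l * avg G (hit G l v (Suc m)) x" if "x \<noteq> v"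
  proof -
    have "hit G l v (Suc m) x = (1 - l) * hit G l v m x + l * avg G (hit G l v m) x"
      using that by simp
    also have "\<dots> \<le> (1 - l) * hit G l v (Suc m) x + l * avg G (hit G l v (Suc m)) x"
      using l by (intro add_mono mult_left_mono Suc avg_mono) auto
    finally show ?thesis .
  qed
  then show ?case
    by (cases "x = v") (simp_all only: hit.simps(2)[of G l v "Suc m"] if_False hit_self simp_thms order_refl if_True)
qed

text \<open>Off the target the growth in \<open>m\<close> equals \<open>l\<close> times the
  difference of the two sides, so monotonicity in time makes \<open>hit\<close> subharmonic
  there.\<close>

lemma hit_le_avg: "x \<noteq> v \<Longrightarrow> hit G l v m x \<le> avg G (hit G l v m) x"
  using hit_Suc_mono[of v m x] l by (simp add: algebra_simps)

text \<open>At the target the linear part of the recursion falls short of 1 by at most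
  \<open>l\<close>. Compensating for this gives one linear bound for all \<open>x\<close>, which can
  be summed over targets or over starting points.\<close>

lemma hit_Suc_le:
  "hit G l v (Suc m) x \<le> (1 - l) * hit G l v m x + l * avg G (hit G l v m) x + l * of_bool (x = v)"
proof -
  have "0 \<le> avg G (hit G l v m) x"
    using avg_mono[of "\<lambda>_. 0" "hit G l v m" x] hit_01 avg_const by auto
  then show ?thesis using l by auto
qed

text \<open>The sum is the expected number of vertices visited; a new one costs a move, and
  \<open>l * m\<close> moves are expected.\<close>

lemma sum_hit_targets: "(\<Sum>v\<in>V. hit G l v m x) \<le> 1 + l * m"
proof (induction m arbitrary: x)
  case 0
  then show ?case using finite_V by (simp add: of_bool_def)
next
  case (Suc m)
  have "avg G (\<lambda>y. \<Sum>v\<in>V. hit G l v m y) x \<le> 1 + l * m"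
    using avg_mono[of "\<lambda>y. \<Sum>v\<in>V. hit G l v m y" "\<lambda>_. 1 + l * m" x] Suc avg_const by simp
  then have *: "(1 - l) * (\<Sum>v\<in>V. hit G l v m x) + l * avg G (\<lambda>y. \<Sum>v\<in>V. hit G l v m y) x \<le> 1 + l * m"
    using Suc[of x] l by (intro convex_bound_le) auto
  have "(\<Sum>v\<in>V. hit G l v (Suc m) x) \<le>
      (\<Sum>v\<in>V. (1 - l) * hit G l v m x + l * avg G (hit G l v m) x + l * of_bool (x = v))"
    by (intro sum_mono hit_Suc_le)
  also have "\<dots> = (1 - l) * (\<Sum>v\<in>V. hit G l v m x) + l * avg G (\<lambda>y. \<Sum>v\<in>V. hit G l v m y) x + l * of_bool (x \<in> V)"
    using finite_V by (simp add: sum.distrib sum_distrib_left[symmetric] avg_sum of_bool_def)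
  also have "\<dots> \<le> 1 + l * Suc m"
    using * l by (auto simp: algebra_simps)
  finally show ?case .
qed

text \<open>Here the averages disappear by stationarity, so each step adds at most \<open>l\<close>.
  Hence a walk from a uniform vertex hits \<open>v\<close> with probability at most
  \<open>(1 + l * m) / card V\<close>.\<close>

lemma sum_hit_starts: "(\<Sum>x\<in>V. hit G l v m x) \<le> 1 + l * m"
proof (induction m)
  case 0
  then show ?case using finite_V by (simp add: of_bool_def)
next
  case (Suc m)
  have "(\<Sum>x\<in>V. hit G l v (Suc m) x) \<le>
      (\<Sum>x\<in>V. (1 - l) * hit G l v m x + l * avg G (hit G l v m) x + l * of_bool (x = v))"
    by (intro sum_mono hit_Suc_le)
  also have "\<dots> = (\<Sum>x\<in>V. hit G l v m x) + l * of_bool (v \<in> V)"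
    using finite_V
    by (simp add: sum.distrib sum_distrib_left[symmetric] sum_avg of_bool_def)
      (simp add: algebra_simps)
  also have "\<dots> \<le> 1 + l * Suc m"
    using Suc l by (auto simp: algebra_simps)
  finally show ?case .
qed

end

section \<open>One step of the process\<close>

text \<open>Ineffective meetings change nothing and the first effective one ends the encounter, so
  at most one pair is replaced.\<close>

lemma meet_cases:
  assumes "S \<in> set_pmf (meet react A Bs)"
  obtains "S = add_mset A (mset Bs)"
  | B S0 R where "mset Bs = add_mset B R" "S0 \<in> set_pmf (react A B)" "S = S0 + R"
proof -
  have "S = add_mset A (mset Bs) \<or>
      (\<exists>B S0 R. mset Bs = add_mset B R \<and> S0 \<in> set_pmf (react A B) \<and> S = S0 + R)"
    using assms
  proof (induction Bs arbitrary: S)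
    case (Cons B Bs)
    from Cons.prems obtain S1 where S1: "S1 \<in> set_pmf (react A B)"
      and S: "S \<in> set_pmf (if S1 = {#A, B#} then map_pmf (add_mset B) (meet react A Bs)
          else return_pmf (S1 + mset Bs))"
      by auto
    show ?case
    proof (cases "S1 = {#A, B#}")
      case True
      then obtain S' where S': "S' \<in> set_pmf (meet react A Bs)" "S = add_mset B S'"
        using S by auto
      from Cons.IH[OF S'(1)] show ?thesis
      proof (elim disjE exE conjE)
        fix B' S0 R
        assume "mset Bs = add_mset B' R" "S0 \<in> set_pmf (react A B')" "S' = S0 + R"
        then show ?thesis
          \<comment> \<open>The particle \<open>B\<close> that was met without effect joins the
            untouched remainder.\<close>
          using S'(2) by (intro disjI2 exI[of _ B'] exI[of _ S0] exI[of _ "add_mset B R"]) auto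
      qed (use S' in auto)
    next
      case False
      then show ?thesis using S S1 by (intro disjI2 exI[of _ B] exI[of _ S1] exI[of _ "mset Bs"]) auto
    qed
  qed auto
  then show thesis using that by blast
qed

lemma arrive_cases:
  assumes "c' \<in> set_pmf (arrive react c B y)"
  obtains "c' = add_mset (y, B) c"
  | B' S R where "c = add_mset (y, B') R" "S \<in> set_pmf (react B B')" "c' = R + image_mset (Pair y) S"
proof -
  define here elsewhere where "here = {#p \<in># c. fst p = y#}" and "elsewhere = {#p \<in># c. fst p \<noteq> y#}"
  have c: "c = here + elsewhere"
    unfolding here_def elsewhere_def by (rule multiset_partition)
  have "set_pmf (pmf_of_set (permutations_of_multiset (image_mset snd here))) =
      permutations_of_multiset (image_mset snd here)"
    by (rule set_pmf_of_set) simp_all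
  then obtain Bs S where Bs: "mset Bs = image_mset snd here" and S: "S \<in> set_pmf (meet react B Bs)"
    and c': "c' = elsewhere + image_mset (Pair y) S"
    using assms unfolding arrive_def here_def[symmetric] elsewhere_def[symmetric]
    by (auto dest: permutations_of_multisetD)
  have "image_mset (Pair y) (image_mset snd here) = image_mset (\<lambda>p. p) here"
    unfolding multiset.map_comp by (rule image_mset_cong) (auto simp: here_def)
  then have here: "here = image_mset (Pair y) (mset Bs)" using Bs by simp
  from S show thesis
  proof (cases rule: meet_cases)
    case 1
    then show ?thesis using that(1) c c' here by simp
  next
    case (2 B' S0 R)
    then show ?thesis
      using that(2)[of B' "elsewhere + image_mset (Pair y) R" S0] c c' here by (simp add: ac_simps)
  qed
qed

section \<open>Equal speeds: uniform selection of the moving particle\<close>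

lemma sum_mset_image_count:
  fixes g :: "'a \<Rightarrow> real"
  assumes "finite S" "set_mset c \<subseteq> S"
  shows "(\<Sum>p\<in>#c. g p) = (\<Sum>p\<in>S. real (count c p) * g p)"
  using assms(2)
proof (induction c)
  case (add q c)
  have "(\<Sum>p\<in>S. real (count (add_mset q c) p) * g p) =
      (\<Sum>p\<in>S. (if p = q then g p else 0) + real (count c p) * g p)"
    by (intro sum.cong) (auto simp: algebra_simps)
  then show ?case using assms(1) add by (simp add: sum.distrib)
qed simp

text \<open>The law of \<open>system_step\<close> given that \<open>p\<close> is the selected
  particle.\<close>

definition move_from ::
    "'v pair_pre_digraph \<Rightarrow> ('t \<Rightarrow> 't \<Rightarrow> 't multiset pmf) \<Rightarrow> ('v, 't) config \<Rightarrow> 'v \<times> 't \<Rightarrow> ('v, 't) config pmf" where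
  "move_from G react c p = (if neighbours G (fst p) = {} then return_pmf c
     else bind_pmf (pmf_of_set (neighbours G (fst p))) (arrive react (c - {#p#}) (snd p)))"

lemma total_speed_const: "(\<And>A. speed A = s) \<Longrightarrow> total_speed speed c = s * real (size c)"
  by (induction c) (auto simp: total_speed_def algebra_simps)

lemma pmf_select_particle_const:
  assumes "\<And>A. speed A = s" "0 < s" "c \<noteq> {#}"
  shows "pmf (select_particle speed c) p = real (count c p) / real (size c)"
proof -
  have "0 < total_speed speed c"
    using assms by (simp add: total_speed_const nonempty_has_size)
  then show ?thesis
    using assms by (subst pmf_select_particle) (auto simp: total_speed_const)
qed

lemma system_step_eq:
  assumes "\<And>A. speed A = s" "0 < s" "c \<noteq> {#}"
  shows "system_step G speed react c = bind_pmf (select_particle speed c) (move_from G react c)"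
  using assms by (auto simp: system_step_def total_speed_const move_from_def intro!: bind_pmf_cong)

lemma expectation_system_step:
  fixes f :: "('v, 't) config \<Rightarrow> real"
  assumes "\<And>A. speed A = s" "0 < s" "c \<noteq> {#}" and "\<And>x. \<bar>f x\<bar> \<le> B"
  shows "measure_pmf.expectation (system_step G speed react c) f =
    (\<Sum>p\<in>#c. measure_pmf.expectation (move_from G react c p) f) / real (size c)"
proof -
  have "measure_pmf.expectation (system_step G speed react c) f =
      measure_pmf.expectation (select_particle speed c)
        (\<lambda>p. measure_pmf.expectation (move_from G react c p) f)"
    using assms by (subst system_step_eq[OF assms(1-3)], subst expectation_bind_pmf_bounded) auto
  also have "\<dots> = (\<Sum>p\<in>set_mset c. pmf (select_particle speed c) p *\<^sub>R
      measure_pmf.expectation (move_from G react c p) f)"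
    by (rule integral_measure_pmf)
      (auto simp: set_pmf_iff pmf_select_particle_const[OF assms(1-3)] not_in_iff)
  also have "\<dots> = (\<Sum>p\<in>#c. measure_pmf.expectation (move_from G react c p) f) / real (size c)"
    by (subst sum_mset_image_count[of "set_mset c"])
      (auto simp: pmf_select_particle_const[OF assms(1-3)] sum_divide_distrib)
  finally show ?thesis .
qed

lemma (in lazy_walk) system_step_cases:
  assumes "\<And>A. speed A = s" "0 < s" and "c' \<in> set_pmf (system_step G speed react c)"
  obtains "c' = c"
  | x B y R where "c = add_mset (x, B) R" "c' \<in> set_pmf (arrive react R B y)"
proof (cases "c = {#}")
  case True
  then have "c' = c" using assms by (simp add: system_step_def total_speed_def)
  then show thesis by (rule that)
next
  case False
  obtain p where p: "p \<in># c" and c': "c' \<in> set_pmf (move_from G react c p)"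
    using assms(3) unfolding system_step_eq[OF assms(1,2) False]
    by (auto simp: set_pmf_iff pmf_select_particle_const[OF assms(1,2) False] not_in_iff)
  show thesis
  proof (cases "neighbours G (fst p) = {}")
    case True
    then show ?thesis using c' that(1) by (simp add: move_from_def)
  next
    case nonempty: False
    then obtain y where "c' \<in> set_pmf (arrive react (c - {#p#}) (snd p) y)"
      using c' finite_neighbours by (auto simp: move_from_def)
    then show ?thesis
      using that(2)[of "fst p" "snd p" "c - {#p#}" y] p by simp
  qed
qed

text \<open>A move is invisible once locations are forgotten, and the at most one reaction is a
  mean-field step. This transfers persistence to every configuration that the process
  reaches.\<close>

lemma (in lazy_walk) system_step_mean_field:
  assumes "\<And>A. speed A = s" "0 < s" and "c' \<in> set_pmf (system_step G speed react c)"
  shows "(mean_field_step react)\<^sup>*\<^sup>* (image_mset snd c) (image_mset snd c')"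
  using assms
proof (cases rule: system_step_cases)
  case (2 x B y R)
  from 2(2) show ?thesis
  proof (cases rule: arrive_cases)
    case 1
    then show ?thesis using 2 by simp
  next
    case (2 B' S R')
    have "mean_field_step react (image_mset snd R' + {#B, B'#}) (image_mset snd R' + S)"
      using 2 by (intro mean_field_step.intros)
    then show ?thesis
      using 2 \<open>c = add_mset (x, B) R\<close> by (simp add: multiset.map_comp o_def add_mset_commute r_into_rtranclp)
  qed
qed simp

section \<open>The potential\<close>

text \<open>Energy is only required not to increase, which covers ineffective reactions as well. The
  lower bound 1 lets Bernoulli's inequality apply with energies as exponents.\<close>

locale energy_walk = lazy_walk G l
  for G :: "'v pair_pre_digraph" and l +
  fixes react :: "'t::finite \<Rightarrow> 't \<Rightarrow> 't multiset pmf" and e :: "'t \<Rightarrow> real" and A :: 't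
  assumes e_ge_1: "1 \<le> e B"
    and e_react: "S \<in> set_pmf (react B C) \<Longrightarrow> (\<Sum>D\<in>#S. e D) \<le> e B + e C"
begin

text \<open>Exponents add when weights at one vertex are multiplied, so an output of no more energy
  weighs at least as much as the pair it replaces.\<close>

definition wt :: "'v \<Rightarrow> nat \<Rightarrow> 'v \<times> 't \<Rightarrow> real" where
  "wt v m p = (1 - hit G l v m (fst p)) powr e (snd p)"

text \<open>
  A lower bound on the probability that the particle of type \<open>A\<close> at \<open>v\<close> is neither selected nor
  visited during \<open>m\<close> lazy steps. As \<open>wt v m\<close> vanishes at \<open>v\<close>, it is zero unless that particle is
  alone at \<open>v\<close>. In a lazy step a given particle moves with probability only \<open>l / 2\<close>; the factor 2
  makes up for comparing a sum over the particles with a product, by \<open>exp (- 2 * x) \<le> 1 - x\<close>.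
\<close>

definition pot :: "'v \<Rightarrow> nat \<Rightarrow> ('v, 't) config \<Rightarrow> real" where
  "pot v m c = (if (v, A) \<in># c then (1 - l) ^ m * (\<Prod>p\<in>#c - {#(v, A)#}. wt v m p) else 0)"

definition total_pot :: "nat \<Rightarrow> ('v, 't) config \<Rightarrow> real" where
  "total_pot m c = (\<Sum>v\<in>V. pot v m c)"

definition total_energy :: "('v, 't) config \<Rightarrow> real" where
  "total_energy c = (\<Sum>p\<in>#c. e (snd p))"

section \<open>Ranges of weights, potentials and energies\<close>

lemma e_nonneg: "0 \<le> e B" using e_ge_1[of B] by simp

lemma wt_01: "0 \<le> wt v m p \<and> wt v m p \<le> 1"
  using hit_01[of v m "fst p"] powr_le1[OF e_nonneg] by (simp add: wt_def)

lemma wt_self [simp]: "wt v m (v, B) = 0"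
  by (simp add: wt_def)

text \<open>Bernoulli's inequality at \<open>1 - hit\<close>: a particle of energy \<open>e\<close>
  behaves like \<open>e\<close> independent walkers in a union bound.\<close>

lemma one_minus_wt_le: "1 - wt v m p \<le> e (snd p) * hit G l v m (fst p)"
  using powr_ge_tangent[of "1 - hit G l v m (fst p)" "e (snd p)"] hit_01 e_ge_1
  by (simp add: wt_def)

lemma l_power_01: "0 \<le> (1 - l) ^ m \<and> (1 - l) ^ m \<le> 1"
  using l by (auto intro: power_le_one)

lemma pot_01: "0 \<le> pot v m c \<and> pot v m c \<le> 1"
  using prod_mset_01[of "c - {#(v, A)#}" "wt v m"] wt_01 l_power_01
  by (auto simp: pot_def intro: mult_le_one)

lemma abs_pot_le: "\<bar>pot v m c\<bar> \<le> 1"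
  using pot_01[of v m c] by simp

lemma total_pot_bounds: "0 \<le> total_pot m c \<and> total_pot m c \<le> card V"
  using sum_bounded_above[of V "\<lambda>v. pot v m c" 1] pot_01
  by (auto simp: total_pot_def intro: sum_nonneg)

lemma abs_total_pot_le: "\<bar>total_pot m c\<bar> \<le> card V"
  using total_pot_bounds[of m c] by simp

lemma total_pot_eq_0: "A \<notin># image_mset snd c \<Longrightarrow> total_pot m c = 0"
  by (force simp: total_pot_def pot_def intro!: sum.neutral)

lemma total_energy_add [simp]:
  "total_energy {#} = 0" "total_energy (add_mset p c) = e (snd p) + total_energy c"
  "total_energy (c + c') = total_energy c + total_energy c'"
  by (auto simp: total_energy_def)

lemma total_energy_image_Pair [simp]:
  "total_energy (image_mset (Pair y) S) = (\<Sum>B\<in>#S. e B)"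
  by (simp add: total_energy_def multiset.map_comp o_def)

lemma total_energy_ge_size: "real (size c) \<le> total_energy c"
proof (induction c)
  case (add p c)
  then show ?case using e_ge_1[of "snd p"] by simp
qed simp

section \<open>Sensitivity of the potential to a few particles\<close>

text \<open>Away from \<open>v\<close>, particles enter only through a product of weights, which
  lies between 1 minus their total hitting chance (weighted by energy) and 1.\<close>

lemma abs_pot_diff_le:
  "\<bar>pot v m (R + S) - pot v m (R + S')\<bar> \<le>
    (\<Sum>p\<in>#S. e (snd p) * hit G l v m (fst p)) + (\<Sum>p\<in>#S'. e (snd p) * hit G l v m (fst p))"
proof -
  let ?H = "\<lambda>S. \<Sum>p\<in>#S. e (snd p) * hit G l v m (fst p)"
  have H_nonneg: "0 \<le> ?H S" for S
    using hit_01 e_nonneg by (induction S) (auto intro!: add_nonneg_nonneg mult_nonneg_nonneg)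
  have H_ge_1: "1 \<le> ?H S" if "p \<in># S" "fst p = v" for S p
  proof -
    obtain S0 where S0: "S = add_mset p S0" using \<open>p \<in># S\<close> by (metis insert_DiffM)
    then show ?thesis using H_nonneg[of S0] that(2) e_ge_1[of "snd p"] by simp
  qed
  \<comment> \<open>A particle of \<open>S\<close> or \<open>S'\<close> at \<open>v\<close> has
    \<open>hit\<close> equal to 1 and energy at least 1, so the right side is then at least 1 and
    the bounds 0 and 1 on \<open>pot\<close> suffice.\<close>
  consider p where "p \<in># S + S'" "fst p = v" | "\<forall>p \<in># S + S'. fst p \<noteq> v" by blast
  then show ?thesis
  proof cases
    case 1
    then have "1 \<le> ?H S + ?H S'"
      using H_ge_1[of p S] H_ge_1[of p S'] H_nonneg[of S] H_nonneg[of S'] by auto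
    then show ?thesis using pot_01[of v m "R + S"] pot_01[of v m "R + S'"] by linarith
  next
    case 2
    have *: "1 - ?H S \<le> (\<Prod>p\<in>#S. wt v m p) \<and> (\<Prod>p\<in>#S. wt v m p) \<le> 1" for S
    proof -
      have "(\<Sum>p\<in>#S. 1 - wt v m p) \<le> ?H S"
        by (intro sum_mset_mono one_minus_wt_le)
      then show ?thesis
        using prod_mset_ge_one_minus_sum[of S "wt v m"] prod_mset_01[of S "wt v m"] wt_01 by force
    qed
    show ?thesis
    proof (cases "(v, A) \<in># R")
      case True
      \<comment> \<open>\<open>K\<close> is the common factor contributed by
        \<open>R\<close>.\<close>
      define K where "K = (1 - l) ^ m * (\<Prod>p\<in>#R - {#(v, A)#}. wt v m p)"
      have K: "0 \<le> K" "K \<le> 1"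
        using prod_mset_01[of "R - {#(v, A)#}" "wt v m"] wt_01 l_power_01
        by (auto simp: K_def intro: mult_le_one)
      have "pot v m (R + T) = K * (\<Prod>p\<in>#T. wt v m p)" for T
      proof -
        from True obtain R0 where "R = add_mset (v, A) R0" by (metis insert_DiffM)
        then show ?thesis by (simp add: pot_def K_def)
      qed
      then have "\<bar>pot v m (R + S) - pot v m (R + S')\<bar> =
          K * \<bar>(\<Prod>p\<in>#S. wt v m p) - (\<Prod>p\<in>#S'. wt v m p)\<bar>"
        using K by (simp add: abs_mult flip: right_diff_distrib)
      also have "\<dots> \<le> \<bar>(\<Prod>p\<in>#S. wt v m p) - (\<Prod>p\<in>#S'. wt v m p)\<bar>"
        using K by (intro mult_left_le_one_le) auto
      also have "\<dots> \<le> ?H S + ?H S'"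
        using *[of S] *[of S'] H_nonneg[of S] H_nonneg[of S'] by linarith
      finally show ?thesis .
    next
      case False
      then have "(v, A) \<notin># R + S" "(v, A) \<notin># R + S'" using 2 by force+
      then show ?thesis using H_nonneg[of S] H_nonneg[of S'] by (simp add: pot_def)
    qed
  qed
qed

lemma sum_energy_hit_le:
  "(\<Sum>v\<in>V. \<Sum>p\<in>#S. e (snd p) * hit G l v m (fst p)) \<le> total_energy S * (1 + l * m)"
proof (induction S)
  case (add p S)
  have "(\<Sum>v\<in>V. e (snd p) * hit G l v m (fst p)) \<le> e (snd p) * (1 + l * m)"
    unfolding sum_distrib_left[symmetric]
    using sum_hit_targets e_nonneg by (intro mult_left_mono)
  then show ?case using add by (simp add: sum.distrib algebra_simps)
qed simp

text \<open>The effect of a particle on the potential at \<open>v\<close> is bounded through its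
  chance of hitting \<open>v\<close>, and it is expected to hit at most \<open>1 + l * m\<close>
  vertices.\<close>

lemma abs_total_pot_diff_le:
  "\<bar>total_pot m (R + S) - total_pot m (R + S')\<bar> \<le> (total_energy S + total_energy S') * (1 + l * m)"
proof -
  have "\<bar>total_pot m (R + S) - total_pot m (R + S')\<bar> \<le> (\<Sum>v\<in>V. \<bar>pot v m (R + S) - pot v m (R + S')\<bar>)"
    unfolding total_pot_def sum_subtractf[symmetric] by (rule sum_abs)
  also have "\<dots> \<le> (\<Sum>v\<in>V. (\<Sum>p\<in>#S. e (snd p) * hit G l v m (fst p)) +
      (\<Sum>p\<in>#S'. e (snd p) * hit G l v m (fst p)))"
    by (intro sum_mono abs_pot_diff_le)
  also have "\<dots> \<le> (total_energy S + total_energy S') * (1 + l * m)"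
    unfolding sum.distrib distrib_right by (intro add_mono sum_energy_hit_le)
  finally show ?thesis .
qed

section \<open>Drift of the potential in one lazy step\<close>

lemma pot_add_self:
  "pot v m (add_mset (v, A) R) = (1 - l) ^ m * (\<Prod>p\<in>#R. wt v m p)"
  by (simp add: pot_def)

text \<open>All weights are powers of one base in the unit interval, and such powers decrease in the
  exponent.\<close>

lemma mult_wt_le_prod_mset_wt:
  assumes "(\<Sum>D\<in>#S. e D) \<le> e B + e C"
  shows "wt v m (y, B) * wt v m (y, C) \<le> (\<Prod>D\<in>#S. wt v m (y, D))"
\<comment> \<open>Base 0 is separate: \<open>0 powr 0\<close> is 0, whereas an empty output has
  product 1.\<close>
proof (cases "hit G l v m y = 1")
  case True
  then show ?thesis using prod_mset_01[of S "\<lambda>D. wt v m (y, D)"] wt_01 by (simp add: wt_def)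
next
  case False
  define u where "u = 1 - hit G l v m y"
  have u: "0 < u" "u \<le> 1" using False hit_01[of v m y] by (auto simp: u_def)
  have "wt v m (y, B) * wt v m (y, C) = u powr (e B + e C)"
    using u by (simp add: wt_def u_def powr_add)
  also have "\<dots> \<le> u powr (\<Sum>D\<in>#S. e D)"
    using u assms by (intro powr_mono') auto
  also have "u powr (\<Sum>D\<in>#S. e D) = (\<Prod>D\<in>#S. u powr e D)"
    using u by (induction S) (auto simp: powr_add)
  finally show ?thesis by (simp add: wt_def u_def)
qed

text \<open>The left side is the potential after the arrival but before any reaction; a reaction can
  only raise it, as the energy does not grow.\<close>

lemma pot_le_pot_arrive:
  assumes "c' \<in> set_pmf (arrive react c B y)"
  shows "pot v m (add_mset (y, B) c) \<le> pot v m c'"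
  using assms
proof (cases rule: arrive_cases)
  case (2 C S R)
  show ?thesis
  proof (cases "y = v")
    case True
    \<comment> \<open>Both reacting particles are at \<open>v\<close>, so no particle is alone
      there.\<close>
    have "pot v m (add_mset (y, B) c) = 0"
    proof (cases "A = B \<or> A = C")
      case False
      then show ?thesis using True 2 by (auto simp: pot_def)
    qed (use True 2 in \<open>auto simp: pot_def\<close>)
    then show ?thesis using pot_01[of v m c'] by simp
  next
    case False
    show ?thesis
    proof (cases "(v, A) \<in># R")
      case True
      then obtain R0 where R0: "R = add_mset (v, A) R0" by (metis insert_DiffM)
      have "pot v m (add_mset (y, B) c) =
          (1 - l) ^ m * (\<Prod>p\<in>#R0. wt v m p) * (wt v m (y, B) * wt v m (y, C))"
        using 2 R0 pot_add_self[of v m "add_mset (y, B) (add_mset (y, C) R0)"]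
        by (simp add: add_mset_commute ac_simps)
      also have "\<dots> \<le> (1 - l) ^ m * (\<Prod>p\<in>#R0. wt v m p) * (\<Prod>D\<in>#S. wt v m (y, D))"
        using l_power_01 prod_mset_01[of R0 "wt v m"] wt_01 mult_wt_le_prod_mset_wt[OF e_react[OF 2(2)]]
        by (intro mult_left_mono) auto
      also have "\<dots> = pot v m c'"
        using 2 R0 pot_add_self[of v m "R0 + image_mset (Pair y) S"]
        by (simp add: multiset.map_comp o_def ac_simps)
      finally show ?thesis .
    next
      case False
      then show ?thesis using 2 \<open>y \<noteq> v\<close> pot_01[of v m c'] by (simp add: pot_def)
    qed
  qed
qed simp

text \<open>\<open>d p\<close> is the relative loss of avoidance probability in one walk step, so a
  lazy step multiplies that probability by \<open>1 - l * d p\<close>, which is at most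
  \<open>exp (- l * d p)\<close>.\<close>

lemma prod_mset_wt_Suc_le:
  assumes "\<And>p. p \<in># R \<Longrightarrow> hit G l v m (fst p) < 1"
  defines "d \<equiv> \<lambda>p. (avg G (hit G l v m) (fst p) - hit G l v m (fst p)) / (1 - hit G l v m (fst p))"
  shows "(\<Prod>p\<in>#R. wt v (Suc m) p) \<le> (\<Prod>p\<in>#R. wt v m p) * exp (- l * (\<Sum>p\<in>#R. e (snd p) * d p))"
  using assms(1)
proof (induction R)
  case (add p R)
  define u where "u = 1 - hit G l v m (fst p)"
  have u: "0 < u" using add.prems[of p] by (simp add: u_def)
  have v: "fst p \<noteq> v" using add.prems[of p] by auto
  have "1 - hit G l v (Suc m) (fst p) = u * (1 - l * d p)"
    using v u by (simp add: d_def u_def field_simps)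
  moreover from this have d: "0 \<le> 1 - l * d p"
    using hit_01[of v "Suc m" "fst p"] u by (metis diff_ge_0_iff_ge zero_le_mult_iff not_less)
  ultimately have "wt v (Suc m) p = wt v m p * (1 - l * d p) powr e (snd p)"
    using u by (simp add: wt_def powr_mult u_def del: hit.simps)
  also have "(1 - l * d p) powr e (snd p) \<le> exp (- l * d p) powr e (snd p)"
    using d e_nonneg exp_ge_add_one_self[of "- l * d p"] by (intro powr_mono2) auto
  also have "\<dots> = exp (- l * (e (snd p) * d p))"
    by (simp add: powr_def ac_simps)
  finally have "wt v (Suc m) p \<le> wt v m p * exp (- l * (e (snd p) * d p))"
    using wt_01[of v m p] by (simp add: mult_left_mono)
  moreover have "(\<Prod>p\<in>#R. wt v (Suc m) p) \<le> (\<Prod>p\<in>#R. wt v m p) * exp (- l * (\<Sum>p\<in>#R. e (snd p) * d p))"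
    using add by simp
  ultimately have "wt v (Suc m) p * (\<Prod>p\<in>#R. wt v (Suc m) p) \<le>
      (wt v m p * exp (- l * (e (snd p) * d p))) *
      ((\<Prod>p\<in>#R. wt v m p) * exp (- l * (\<Sum>p\<in>#R. e (snd p) * d p)))"
    using wt_01 prod_mset_01[of R "wt v (Suc m)"] by (intro mult_mono) auto
  also have "\<dots> = wt v m p * (\<Prod>p\<in>#R. wt v m p) * exp (- l * (e (snd p) * d p + (\<Sum>p\<in>#R. e (snd p) * d p)))"
    by (simp add: distrib_left exp_add exp_diff exp_minus field_simps)
  finally show ?case by (simp add: mult.assoc)
qed simp

text \<open>Moving \<open>p\<close> to \<open>y\<close> multiplies its weight by a power of the
  ratio of avoidance probabilities. Bernoulli's inequality linearises this power, and the mean ratio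
  over the neighbours is \<open>1 - d\<close>.\<close>

lemma expectation_pot_move_from_ge:
  assumes "p \<in># R" "hit G l v m (fst p) < 1"
  defines "d \<equiv> (avg G (hit G l v m) (fst p) - hit G l v m (fst p)) / (1 - hit G l v m (fst p))"
  shows "(1 - l) ^ m * (\<Prod>p\<in>#R. wt v m p) * (1 - e (snd p) * d) \<le>
    measure_pmf.expectation (move_from G react (add_mset (v, A) R) p) (pot v m)"
proof (cases "neighbours G (fst p) = {}")
  \<comment> \<open>At an isolated vertex nothing moves and \<open>d\<close> is 0.\<close>
  case True
  then show ?thesis by (simp add: move_from_def d_def avg_def pot_add_self)
next
  case False
  let ?N = "neighbours G (fst p)"
  define u where "u = 1 - hit G l v m (fst p)"
  have u: "0 < u" using assms(2) by (simp add: u_def)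
  obtain R0 where R0: "R = add_mset p R0" using assms(1) by (metis insert_DiffM)
  define K where "K = (1 - l) ^ m * (\<Prod>p\<in>#R0. wt v m p)"
  have K: "0 \<le> K"
    using l_power_01 prod_mset_01[of R0 "wt v m"] wt_01 by (simp add: K_def)
  have card: "card ?N \<noteq> 0" using False finite_neighbours by simp
  let ?r = "\<lambda>y. (1 - hit G l v m y) / u"
  have ge: "K * (wt v m p * (1 + e (snd p) * (?r y - 1))) \<le>
      measure_pmf.expectation (arrive react (add_mset (v, A) R0) (snd p) y) (pot v m)" for y
  proof -
    have "wt v m p * (1 + e (snd p) * (?r y - 1)) \<le> wt v m p * ?r y powr e (snd p)"
      using wt_01 u hit_01 e_ge_1 by (intro mult_left_mono powr_ge_tangent) auto
    also have "\<dots> = wt v m (y, snd p)"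
      using u hit_01[of v m y] by (simp add: wt_def u_def[symmetric] powr_divide)
    finally have "K * (wt v m p * (1 + e (snd p) * (?r y - 1))) \<le> K * wt v m (y, snd p)"
      using K by (rule mult_left_mono)
    also have "\<dots> = pot v m (add_mset (y, snd p) (add_mset (v, A) R0))"
      using pot_add_self[of v m "add_mset (y, snd p) R0"] by (simp add: K_def add_mset_commute)
    also have "\<dots> \<le> measure_pmf.expectation (arrive react (add_mset (v, A) R0) (snd p) y) (pot v m)"
      by (intro expectation_ge_pmf[OF abs_pot_le] pot_le_pot_arrive)
    finally show ?thesis .
  qed
  have "measure_pmf.expectation (move_from G react (add_mset (v, A) R) p) (pot v m) =
      (\<Sum>y\<in>?N. measure_pmf.expectation (arrive react (add_mset (v, A) R0) (snd p) y) (pot v m)) / card ?N"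
    using False finite_neighbours R0
    by (simp add: move_from_def expectation_bind_pmf_bounded[OF abs_pot_le] integral_pmf_of_set
        add_mset_commute)
  moreover have "(\<Sum>y\<in>?N. K * (wt v m p * (1 + e (snd p) * (?r y - 1)))) / card ?N \<le> \<dots>"
    by (intro divide_right_mono sum_mono ge) auto
  moreover have "(\<Sum>y\<in>?N. K * (wt v m p * (1 + e (snd p) * (?r y - 1)))) / card ?N =
      K * (wt v m p * (1 + e (snd p) * ((1 - avg G (hit G l v m) (fst p)) / u - 1)))"
  proof -
    have "(\<Sum>y\<in>?N. ?r y) / card ?N = (1 - avg G (hit G l v m) (fst p)) / u"
      using False card by (simp add: avg_def sum_divide_distrib[symmetric] sum_subtractf diff_divide_distrib)
    then have "(\<Sum>y\<in>?N. ?r y) = card ?N * ((1 - avg G (hit G l v m) (fst p)) / u)"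
      using card by (simp add: divide_eq_eq mult.commute)
    then have "(\<Sum>y\<in>?N. K * (wt v m p * (1 + e (snd p) * (?r y - 1)))) =
      card ?N * (K * (wt v m p * (1 + e (snd p) * ((1 - avg G (hit G l v m) (fst p)) / u - 1))))"
      by (simp only: sum_distrib_left[symmetric] sum.distrib sum_subtractf sum_constant)
        (simp add: algebra_simps)
    then show ?thesis using card by simp
  qed
  moreover have "(1 - avg G (hit G l v m) (fst p)) / u - 1 = - d"
    using u by (simp add: d_def u_def field_simps)
  ultimately show ?thesis by (simp add: R0 K_def ac_simps)
qed

text \<open>The right side is the expected potential after a lazy step that selects each particle
  with probability \<open>l / 2\<close>. The loss of potential is compared with the factor gained by
  lowering the remaining time from \<open>Suc m\<close> to \<open>m\<close>.\<close>

lemma pot_drift: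
  assumes "l * total_energy c \<le> 1"
  shows "pot v (Suc m) c \<le> (1 - l * size c / 2) * pot v m c +
    l / 2 * (\<Sum>p\<in>#c. measure_pmf.expectation (move_from G react c p) (pot v m))"
proof -
  let ?E = "\<lambda>p. measure_pmf.expectation (move_from G react c p) (pot v m)"
  have E_nonneg: "0 \<le> ?E p" for p
    using pot_01 by (intro Bochner_Integration.integral_nonneg) auto
  have sum_nonneg: "0 \<le> (\<Sum>p\<in>#S. ?E p)" for S
    using E_nonneg by (induction S) auto
  have "l * size c \<le> 1"
    using total_energy_ge_size[of c] l assms mult_left_mono[of "real (size c)" "total_energy c" l] by linarith
  then have rhs_nonneg: "0 \<le> (1 - l * size c / 2) * pot v m c + l / 2 * (\<Sum>p\<in>#c. ?E p)"
    using l pot_01 sum_nonneg by (intro add_nonneg_nonneg mult_nonneg_nonneg) auto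
  show ?thesis
  proof (cases "(v, A) \<in># c")
    case False
    then show ?thesis using rhs_nonneg by (simp add: pot_def)
  next
    case True
    then obtain R where R: "c = add_mset (v, A) R" by (metis insert_DiffM)
    show ?thesis
    proof (cases "\<forall>p\<in>#R. hit G l v m (fst p) < 1")
      \<comment> \<open>Another particle certain to hit \<open>v\<close> makes the left side 0;
        otherwise the denominators in \<open>d\<close> are positive.\<close>
      case False
      then obtain p R0 where p: "R = add_mset p R0" "hit G l v m (fst p) = 1"
        using hit_01 by (metis insert_DiffM order_le_less)
      then have "hit G l v (Suc m) (fst p) = 1"
        using hit_Suc_mono[of v m "fst p"] hit_01[of v "Suc m" "fst p"] by linarith
      then have "wt v (Suc m) p = 0" by (simp add: wt_def del: hit.simps)
      then have "pot v (Suc m) c = 0" using p R pot_add_self[of v "Suc m" R] by simp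
      then show ?thesis using rhs_nonneg by simp
    next
      case True
      define d where "d p = (avg G (hit G l v m) (fst p) - hit G l v m (fst p)) / (1 - hit G l v m (fst p))" for p :: "'v \<times> 't"
      define D where "D = (\<Sum>p\<in>#R. e (snd p) * d p)"
      define K where "K = (1 - l) ^ m * (\<Prod>p\<in>#R. wt v m p)"
      have K: "0 \<le> K"
        using l_power_01 prod_mset_01[of R "wt v m"] wt_01 by (simp add: K_def)
      have d: "0 \<le> d p \<and> d p \<le> 1" if "p \<in># R" for p
      proof -
        have "fst p \<noteq> v" using True that by auto
        then have "hit G l v m (fst p) \<le> avg G (hit G l v m) (fst p)" by (rule hit_le_avg)
        moreover have "avg G (hit G l v m) (fst p) \<le> 1"
          using avg_mono[of "hit G l v m" "\<lambda>_. 1" "fst p"] hit_01 avg_const by auto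
        ultimately show ?thesis using True that by (auto simp: d_def divide_le_eq_1)
      qed
      have D_bounds: "0 \<le> D \<and> D \<le> total_energy R"
        unfolding D_def using d
      proof (induction R)
        case (add p R)
        have "0 \<le> e (snd p) * d p" "e (snd p) * d p \<le> e (snd p)"
          using add.prems[of p] e_nonneg by (auto intro: mult_left_le)
        then show ?case using add by auto
      qed simp
      have E_ge: "K * (1 - e (snd p) * d p) \<le> ?E p" if "p \<in># R" for p
        using expectation_pot_move_from_ge[OF that, of v m] True that by (simp add: K_def d_def R)
      have "K * (real (size R) - D) \<le> (\<Sum>p\<in>#R. ?E p)"
        unfolding D_def using E_ge
      proof (induction R)
        case (add p R)
        have "K * (1 - e (snd p) * d p) \<le> ?E p" by (rule add.prems) simp
        moreover have "K * (real (size R) - (\<Sum>p\<in>#R. e (snd p) * d p)) \<le> (\<Sum>p\<in>#R. ?E p)"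
          by (rule add.IH, rule add.prems) simp
        ultimately show ?case by (simp add: algebra_simps)
      qed simp
      \<comment> \<open>A move of the particle at \<open>v\<close> itself is only credited with a
        nonnegative value.\<close>
      then have sum_ge: "K * (real (size R) - D) \<le> (\<Sum>p\<in>#c. ?E p)"
        using E_nonneg[of "(v, A)"] by (simp add: R)
      \<comment> \<open>\<open>x\<close> is the relative loss in a lazy step: \<open>l / 2\<close>
        for moving the particle at \<open>v\<close>, and \<open>l / 2 * D\<close> for moving the
        others.\<close>
      define x where "x = l / 2 * (1 + D)"
      \<comment> \<open>The summand 1 is covered by the energy of the particle at
        \<open>v\<close>.\<close>
      have "l * (1 + D) \<le> 1"
        using D_bounds e_ge_1[of A] l by (intro order_trans[OF mult_left_mono assms]) (auto simp: R)
      then have x: "0 \<le> x" "x \<le> 1 / 2" using l D_bounds by (auto simp: x_def)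
      have "pot v (Suc m) c = (1 - l) * ((1 - l) ^ m * (\<Prod>p\<in>#R. wt v (Suc m) p))"
        by (simp add: R pot_add_self ac_simps)
      also have "\<dots> \<le> (1 - l) * ((1 - l) ^ m * ((\<Prod>p\<in>#R. wt v m p) * exp (- l * D)))"
        using prod_mset_wt_Suc_le[of R v m] True l l_power_01
        by (intro mult_left_mono) (auto simp: D_def d_def)
      also have "\<dots> \<le> exp (- l) * ((1 - l) ^ m * ((\<Prod>p\<in>#R. wt v m p) * exp (- l * D)))"
        using exp_ge_add_one_self[of "- l"] K unfolding K_def
        by (intro mult_right_mono) (auto simp flip: mult.assoc)
      also have "\<dots> = K * exp (- 2 * x)"
      proof -
        have "- 2 * x = - (l * (1 + D))" by (simp add: x_def)
        also have "\<dots> = - l + - l * D" by (simp add: distrib_left)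
        finally have "- 2 * x = - l + - l * D" .
        then show ?thesis by (simp only: exp_add K_def ac_simps)
      qed
      also have "\<dots> \<le> K * (1 - x)"
        using x K by (intro mult_left_mono exp_le_one_minus)
      also have "\<dots> = (1 - l * size c / 2) * K + l / 2 * (K * (real (size R) - D))"
        by (simp add: R x_def field_simps)
      also have "\<dots> \<le> (1 - l * size c / 2) * K + l / 2 * (\<Sum>p\<in>#c. ?E p)"
        using sum_ge l by (intro add_left_mono mult_left_mono) auto
      finally show ?thesis by (simp add: K_def R pot_add_self)
    qed
  qed
qed

lemma total_pot_drift:
  assumes "l * total_energy c \<le> 1" "c \<noteq> {#}" "\<And>B. speed B = s" "0 < s"
  shows "total_pot (Suc m) c \<le> (1 - l * size c / 2) * total_pot m c +
    l * size c / 2 * measure_pmf.expectation (system_step G speed react c) (total_pot m)"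
proof -
  have "measure_pmf.expectation (system_step G speed react c) (total_pot m) =
      (\<Sum>v\<in>V. measure_pmf.expectation (system_step G speed react c) (pot v m))"
    unfolding total_pot_def
    by (intro Bochner_Integration.integral_sum integrable_pmf_bounded[OF abs_pot_le])
  also have "\<dots> = (\<Sum>v\<in>V. (\<Sum>p\<in>#c. measure_pmf.expectation (move_from G react c p) (pot v m)) / size c)"
    using assms abs_pot_le by (intro sum.cong refl expectation_system_step) auto
  finally have "l * size c / 2 * measure_pmf.expectation (system_step G speed react c) (total_pot m) =
      (\<Sum>v\<in>V. l / 2 * (\<Sum>p\<in>#c. measure_pmf.expectation (move_from G react c p) (pot v m)))"
    unfolding sum_distrib_left using assms(2) by (simp only:) (simp add: sum_distrib_left)
  then have "(1 - l * size c / 2) * total_pot m c +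
    l * size c / 2 * measure_pmf.expectation (system_step G speed react c) (total_pot m) =
    (\<Sum>v\<in>V. (1 - l * size c / 2) * pot v m c +
      l / 2 * (\<Sum>p\<in>#c. measure_pmf.expectation (move_from G react c p) (pot v m)))"
    by (simp add: total_pot_def sum.distrib sum_distrib_left)
  then show ?thesis
    unfolding total_pot_def[of "Suc m"] using pot_drift[OF assms(1)] by (simp add: sum_mono)
qed

end

section \<open>Failure probabilities\<close>

text \<open>Used with \<open>q = l * size c / 2\<close>, so that each particle is selected with
  probability \<open>l / 2\<close> however many remain.\<close>

definition lazy_step where
  "lazy_step G speed react q c =
     bind_pmf (bernoulli_pmf q) (\<lambda>b. if b then system_step G speed react c else return_pmf c)"

lemma expectation_lazy_step:
  fixes f :: "('v, 't) config \<Rightarrow> real"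
  assumes "0 \<le> q" "q \<le> 1" "\<And>x. \<bar>f x\<bar> \<le> B"
  shows "measure_pmf.expectation (lazy_step G speed react q c) f =
    q * measure_pmf.expectation (system_step G speed react c) f + (1 - q) * f c"
  unfolding lazy_step_def
  by (subst expectation_bind_pmf_bounded[OF assms(3)]) (use assms in simp)

definition fail_prob where
  "fail_prob G speed react A T c =
     measure_pmf.prob (trajectory G speed react T c) {cs. \<not> not_yet_eliminated A cs}"

lemma fail_prob_bounds: "0 \<le> fail_prob G speed react A T c \<and> fail_prob G speed react A T c \<le> 1"
  by (simp add: fail_prob_def)

lemma fail_prob_0: "A \<in># image_mset snd c \<Longrightarrow> fail_prob G speed react A 0 c = 0"
  by (simp add: fail_prob_def not_yet_eliminated_def measure_return)

lemma fail_prob_Suc: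
  assumes "A \<in># image_mset snd c"
  shows "fail_prob G speed react A (Suc T) c =
    measure_pmf.expectation (system_step G speed react c) (fail_prob G speed react A T)"
proof -
  have "((#) c) -` {cs. \<not> not_yet_eliminated A cs} = {cs. \<not> not_yet_eliminated A cs}"
    using assms by (auto simp: not_yet_eliminated_def)
  then show ?thesis
    unfolding fail_prob_def trajectory.simps prob_bind_pmf by simp
qed

context energy_walk
begin

lemma total_energy_mean_field:
  assumes "(mean_field_step react)\<^sup>*\<^sup>* M M'"
  shows "(\<Sum>B\<in>#M'. e B) \<le> (\<Sum>B\<in>#M. e B)"
  using assms
proof (induction rule: rtranclp_induct)
  case (step M1 M2)
  from step(2) have "(\<Sum>B\<in>#M2. e B) \<le> (\<Sum>B\<in>#M1. e B)"
    by cases (use e_react in \<open>auto simp: add.assoc\<close>)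
  then show ?case using step by simp
qed simp

lemma total_energy_image_snd: "total_energy c = (\<Sum>B\<in>#image_mset snd c. e B)"
  by (simp add: total_energy_def multiset.map_comp o_def)

text \<open>At most two particles, of energy at most \<open>2 * emax\<close>, are replaced by an
  output of no more energy; this gives the factor 4.\<close>

lemma abs_total_pot_step_le:
  fixes emax :: real
  assumes "\<And>B. speed B = s" "0 < s" and "c' \<in> set_pmf (system_step G speed react c)"
    and "\<And>B. e B \<le> emax"
  shows "\<bar>total_pot m c' - total_pot m c\<bar> \<le> 4 * emax * (1 + l * m)"
  using assms(1-3)
proof (cases rule: system_step_cases)
  case 1
  have "0 \<le> emax" using assms(4) e_nonneg order_trans by blast
  then show ?thesis using 1 l by simp
next
  case (2 x B y R)
  have "\<exists>R S S'. c' = R + S \<and> c = R + S' \<and> total_energy S + total_energy S' \<le> 4 * emax"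
    using 2(2)
  proof (cases rule: arrive_cases)
    case 1
    then show ?thesis
      using 2 assms(4)[of B] e_nonneg[of B]
      by (intro exI[of _ R] exI[of _ "{#(y, B)#}"] exI[of _ "{#(x, B)#}"]) auto
  next
    case (2 C S R')
    then show ?thesis
      using \<open>c = add_mset (x, B) R\<close> assms(4)[of B] assms(4)[of C] e_react[OF 2(2)]
      by (intro exI[of _ R'] exI[of _ "image_mset (Pair y) S"] exI[of _ "{#(x, B), (y, C)#}"]) auto
  qed
  then obtain R S S' where "c' = R + S" "c = R + S'" and S: "total_energy S + total_energy S' \<le> 4 * emax"
    by blast
  then have "\<bar>total_pot m c' - total_pot m c\<bar> \<le> (total_energy S + total_energy S') * (1 + l * m)"
    using abs_total_pot_diff_le by simp
  also have "\<dots> \<le> 4 * emax * (1 + l * m)"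
    using S l by (intro mult_right_mono) auto
  finally show ?thesis .
qed

text \<open>
  The process is compared with its lazy version, in which every particle moves at a constant rate:
  \<open>2 ^ T * (1 - p / 2) ^ m\<close> bounds the probability that \<open>m\<close> lazy steps contain fewer than \<open>T\<close>
  genuine ones, and the other term bounds the probability that the potential reaches zero.
\<close>

lemma fail_prob_le:
  fixes emax p \<theta> :: real
  assumes speed: "\<And>B. speed B = s" "0 < s" and emax: "\<And>B. e B \<le> emax"
    and start: "l * total_energy c0 \<le> 1"
    and persist: "\<And>M. (mean_field_step react)\<^sup>*\<^sup>* (image_mset snd c0) M \<Longrightarrow> M \<noteq> {#} \<and> 2 * p \<le> l * size M"
    and p: "0 \<le> p" and \<theta>: "0 < \<theta>"
    and b: "b = 4 * emax * (1 + l * m0)"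
    and "m \<le> m0" "(mean_field_step react)\<^sup>*\<^sup>* (image_mset snd c0) (image_mset snd c)"
  shows "fail_prob G speed react A T c \<le>
    2 ^ T * (1 - p / 2) ^ m + ((max 0 (\<theta> - total_pot m c))\<^sup>2 + real m * b\<^sup>2) / \<theta>\<^sup>2"
  using assms(9,10)
proof (induction m arbitrary: T c)
  case 0
  have "1 \<le> (2::real) ^ T" "0 \<le> (max 0 (\<theta> - total_pot 0 c))\<^sup>2 / \<theta>\<^sup>2" by simp_all
  then have "fail_prob G speed react A T c \<le> 2 ^ T + (max 0 (\<theta> - total_pot 0 c))\<^sup>2 / \<theta>\<^sup>2"
    using fail_prob_bounds[of G speed react A T c] by linarith
  then show ?case by simp
next
  case (Suc m)
  define q where "q = l * size c / 2"
  have c: "c \<noteq> {#}" "p \<le> q" using persist[OF Suc.prems(2)] by (auto simp: q_def)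
  have energy: "l * total_energy c \<le> 1"
    using total_energy_mean_field[OF Suc.prems(2)] l
    by (intro order_trans[OF mult_left_mono start]) (auto simp: total_energy_image_snd)
  have "l * size c \<le> 1"
    using total_energy_ge_size l by (intro order_trans[OF mult_left_mono energy]) auto
  then have q: "0 \<le> q" "q \<le> 1" using l by (auto simp: q_def)
  have p1: "0 \<le> 1 - p / 2" using c q by simp
  show ?case
  proof (cases "A \<in># image_mset snd c")
    case False
    \<comment> \<open>Without \<open>A\<close> the potential is 0, so the shortfall is all of
      \<open>\<theta>\<close> and the bound is at least 1.\<close>
    then have "((max 0 (\<theta> - total_pot (Suc m) c))\<^sup>2 + real (Suc m) * b\<^sup>2) / \<theta>\<^sup>2 \<ge> 1"
      using \<theta> by (simp add: total_pot_eq_0)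
    then show ?thesis
      using fail_prob_bounds[of G speed react A T c] p1 by (smt (verit) zero_le_mult_iff zero_le_power)
  next
    case True
    show ?thesis
    proof (cases T)
      case 0
      then show ?thesis using True p1 by (simp add: fail_prob_0 del: of_nat_Suc)
    next
      case (Suc T')
      let ?D = "\<lambda>c. (max 0 (\<theta> - total_pot m c))\<^sup>2"
      have D_bdd: "\<bar>?D c\<bar> \<le> \<theta>\<^sup>2" for c
        using total_pot_bounds[of m c] \<theta> by (auto intro!: power_mono)
      have m: "m \<le> m0" using Suc.prems by simp
      have IH': "fail_prob G speed react A T' c' \<le> 2 ^ T' * (1 - p / 2) ^ m + (?D c' + real m * b\<^sup>2) / \<theta>\<^sup>2"
        if "c' \<in> set_pmf (system_step G speed react c)" for c'
        using system_step_mean_field[OF speed that] Suc.prems(2) by (intro Suc.IH m) auto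
      have "fail_prob G speed react A T c =
          measure_pmf.expectation (system_step G speed react c) (fail_prob G speed react A T')"
        using True Suc by (simp add: fail_prob_Suc)
      also have "\<dots> \<le> measure_pmf.expectation (system_step G speed react c)
          (\<lambda>c'. 2 ^ T' * (1 - p / 2) ^ m + (?D c' + real m * b\<^sup>2) / \<theta>\<^sup>2)"
      proof (rule expectation_mono_pmf[OF _ _ IH'])
        show "\<bar>fail_prob G speed react A T' c'\<bar> \<le> 1" for c'
          using fail_prob_bounds[of G speed react A T' c'] by auto
        show "\<bar>2 ^ T' * (1 - p / 2) ^ m + (?D c' + real m * b\<^sup>2) / \<theta>\<^sup>2\<bar> \<le>
            2 ^ T' * (1 - p / 2) ^ m + (\<theta>\<^sup>2 + real m * b\<^sup>2) / \<theta>\<^sup>2" for c'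
        proof -
          have "?D c' \<le> \<theta>\<^sup>2" using D_bdd[of c'] by simp
          then have "(?D c' + real m * b\<^sup>2) / \<theta>\<^sup>2 \<le> (\<theta>\<^sup>2 + real m * b\<^sup>2) / \<theta>\<^sup>2"
            by (intro divide_right_mono) auto
          moreover have "0 \<le> (?D c' + real m * b\<^sup>2) / \<theta>\<^sup>2" by simp
          moreover have "0 \<le> 2 ^ T' * (1 - p / 2) ^ m" using p1 by simp
          ultimately show ?thesis by linarith
        qed
      qed
      also have "\<dots> = 2 ^ T' * (1 - p / 2) ^ m +
          (measure_pmf.expectation (system_step G speed react c) ?D + real m * b\<^sup>2) / \<theta>\<^sup>2"
        using integrable_pmf_bounded[OF D_bdd, of "system_step G speed react c"] by simp
      finally have step: "fail_prob G speed react A T c \<le> \<dots>" .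
      \<comment> \<open>An idle lazy step lowers \<open>m\<close> but keeps \<open>T\<close> and
        \<open>c\<close>; a genuine one also lowers \<open>T\<close>. The induction hypothesis is
        used for both and averaged with weights \<open>1 - q\<close> and \<open>q\<close>.\<close>
      have "fail_prob G speed react A T c \<le> 2 ^ T * (1 - p / 2) ^ m + (?D c + real m * b\<^sup>2) / \<theta>\<^sup>2"
        by (intro Suc.IH m Suc.prems)
      then have "(1 - q) * fail_prob G speed react A T c + q * fail_prob G speed react A T c \<le>
          (1 - q) * (2 ^ T * (1 - p / 2) ^ m + (?D c + real m * b\<^sup>2) / \<theta>\<^sup>2) +
          q * (2 ^ T' * (1 - p / 2) ^ m +
          (measure_pmf.expectation (system_step G speed react c) ?D + real m * b\<^sup>2) / \<theta>\<^sup>2)"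
        using step q by (intro add_mono mult_left_mono) auto
      \<comment> \<open>The first term comes from
        \<open>(1 - q) * 2 ^ T + q * 2 ^ T' = 2 ^ T * (1 - q / 2)\<close>, as
        \<open>T = Suc T'\<close>.\<close>
      also have "\<dots> = 2 ^ T * (1 - q / 2) * (1 - p / 2) ^ m +
          ((q * measure_pmf.expectation (system_step G speed react c) ?D + (1 - q) * ?D c) + real m * b\<^sup>2) / \<theta>\<^sup>2"
        using \<theta> by (simp add: Suc field_simps)
      also have "q * measure_pmf.expectation (system_step G speed react c) ?D + (1 - q) * ?D c =
          measure_pmf.expectation (lazy_step G speed react q c) ?D"
        using q by (rule expectation_lazy_step[OF _ _ D_bdd, symmetric])
      also have "\<dots> \<le> (max 0 (\<theta> - total_pot (Suc m) c))\<^sup>2 + b\<^sup>2"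
      proof (rule expectation_pos_part_square_le)
        have emax0: "0 \<le> emax" using emax e_nonneg order_trans by blast
        fix c' assume "c' \<in> set_pmf (lazy_step G speed react q c)"
        then have "c' = c \<or> c' \<in> set_pmf (system_step G speed react c)"
          by (auto simp: lazy_step_def split: if_splits)
        then have "\<bar>total_pot m c' - total_pot m c\<bar> \<le> 4 * emax * (1 + l * m)"
          using abs_total_pot_step_le[OF speed _ emax] emax0 l by auto
        also have "\<dots> \<le> b"
          unfolding b using emax0 l m by (intro mult_left_mono add_left_mono) auto
        finally show "\<bar>total_pot m c' - total_pot m c\<bar> \<le> b" .
      next
        show "total_pot (Suc m) c \<le> measure_pmf.expectation (lazy_step G speed react q c) (total_pot m)"
          unfolding expectation_lazy_step[OF q abs_total_pot_le]
          using total_pot_drift[of c speed s m, OF energy c(1) speed]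
          by (simp only: q_def add.commute)
      qed
      also have "2 ^ T * (1 - q / 2) * (1 - p / 2) ^ m \<le> 2 ^ T * (1 - p / 2) * (1 - p / 2) ^ m"
        using c p1 by (intro mult_right_mono mult_left_mono) auto
      finally show ?thesis using \<theta> by (simp add: algebra_simps divide_right_mono)
    qed
  qed
qed

end

section \<open>The initial configuration\<close>

definition labels :: "('t \<Rightarrow> nat) \<Rightarrow> ('t \<times> nat) set" where
  "labels k = (SIGMA B:UNIV. {..<k B})"

definition placed :: "('t \<Rightarrow> nat) \<Rightarrow> ('t \<times> nat \<Rightarrow> 'v) \<Rightarrow> ('v, 't) config" where
  "placed k x = image_mset (\<lambda>p. (x p, fst p)) (mset_set (labels k))"

lemma finite_labels [simp]: "finite (labels (k :: 't::finite \<Rightarrow> nat))"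
  by (simp add: labels_def)

lemma card_labels: "card (labels (k :: 't::finite \<Rightarrow> nat)) = (\<Sum>B\<in>UNIV. k B)"
  by (simp add: labels_def)

lemma uniform_start_eq:
  "uniform_start W k = map_pmf (placed k) (Pi_pmf (labels k) undefined (\<lambda>_. pmf_of_set W))"
  by (simp add: uniform_start_def placed_def[abs_def] labels_def Let_def)

lemma image_snd_placed:
  fixes k :: "'t::finite \<Rightarrow> nat"
  shows "image_mset snd (placed k x) = (\<Sum>B\<in>UNIV. replicate_mset (k B) B)"
proof (rule multiset_eqI)
  fix B
  have "labels k \<inter> {p. fst p = B} = Pair B ` {..<k B}"
    by (auto simp: labels_def)
  then have "card {p \<in> labels k. fst p = B} = k B"
    by (simp add: Collect_conj_eq card_image inj_on_def)
  then have "count (image_mset snd (placed k x)) B = k B"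
    by (simp add: placed_def multiset.map_comp o_def count_image_mset_eq_card_vimage)
  moreover have "count (\<Sum>C\<in>UNIV. replicate_mset (k C) C) B = k B"
    by (simp add: count_sum)
  ultimately show "count (image_mset snd (placed k x)) B = count (\<Sum>C\<in>UNIV. replicate_mset (k C) C) B"
    by simp
qed

context energy_walk
begin

lemma total_energy_placed_le:
  fixes emax :: real
  assumes "\<And>B. e B \<le> emax"
  shows "total_energy (placed k x) \<le> emax * (\<Sum>B\<in>UNIV. k B)"
proof -
  have "total_energy (placed k x) = (\<Sum>p\<in>labels k. e (fst p))"
    by (simp add: total_energy_def placed_def multiset.map_comp o_def sum_unfold_sum_mset)
  also have "\<dots> \<le> emax * (\<Sum>B\<in>UNIV. k B)"
    using sum_bounded_above[of "labels k" "\<lambda>p. e (fst p)" emax] assms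
    by (simp add: card_labels mult.commute)
  finally show ?thesis .
qed

lemma abs_total_pot_placed_diff_le:
  fixes emax :: real
  assumes "\<And>B. e B \<le> emax"
  shows "\<bar>total_pot m (placed k (x(i := y))) - total_pot m (placed k (x(i := y')))\<bar> \<le>
    4 * emax * (1 + l * m)"
proof -
  have emax: "0 \<le> emax" using assms e_nonneg order_trans by blast
  show ?thesis
  proof (cases "i \<in> labels k")
    case True
    define R where "R = image_mset (\<lambda>p. (x p, fst p)) (mset_set (labels k - {i}))"
    have "placed k (x(i := z)) = R + {#(z, fst i)#}" for z
    proof -
      have "mset_set (labels k) = add_mset i (mset_set (labels k - {i}))"
        using True by (simp add: mset_set.remove)
      then show ?thesis
        by (auto simp: placed_def R_def intro!: image_mset_cong)
    qed
    then have "\<bar>total_pot m (placed k (x(i := y))) - total_pot m (placed k (x(i := y')))\<bar> \<le>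
        (e (fst i) + e (fst i)) * (1 + l * m)"
      using abs_total_pot_diff_le[of m R "{#(y, fst i)#}" "{#(y', fst i)#}"] by simp
    \<comment> \<open>Relaxed from 2 to 4 so that a single \<open>b\<close> serves for the placement
      and for the steps.\<close>
    also have "\<dots> \<le> 4 * emax * (1 + l * m)"
      using assms[of "fst i"] emax l by (intro mult_right_mono) auto
    finally show ?thesis .
  next
    case False
    then have "placed k (x(i := z)) = placed k x" for z
      by (auto simp: placed_def intro!: image_mset_cong)
    then show ?thesis using emax l by simp
  qed
qed

section \<open>Expected initial potential\<close>

text \<open>If particle \<open>(A, i)\<close> is at \<open>v\<close>, its weight 0 kills every
  summand but the one for \<open>i\<close>. The products have one factor per particle, so their
  expectations factorise.\<close>

lemma pot_placed_ge:
  "(1 - l) ^ m * (\<Sum>i<k A. \<Prod>p\<in>labels k. if p = (A, i) then of_bool (x p = v) else wt v m (x p, fst p)) \<le>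
   pot v m (placed k x)" (is "_ * (\<Sum>i<k A. ?P i) \<le> _")
proof (cases "\<exists>i<k A. x (A, i) = v")
  case False
  then have "?P i = 0" if "i < k A" for i
    using that by (intro prod_zero bexI[of _ "(A, i)"]) (auto simp: labels_def)
  then have "(\<Sum>i<k A. ?P i) = 0" by (intro sum.neutral) auto
  then show ?thesis using pot_01[of v m "placed k x"] by simp
next
  case True
  then obtain i where i: "i < k A" "x (A, i) = v" by blast
  have "?P j = 0" if "j < k A" "j \<noteq> i" for j
    using that i by (intro prod_zero bexI[of _ "(A, i)"]) (auto simp: labels_def)
  then have "(\<Sum>j<k A. ?P j) = (\<Sum>j\<in>{i}. ?P j)"
    using i by (intro sum.mono_neutral_right) auto
  also have "\<dots> = (\<Prod>p\<in>labels k - {(A, i)}. wt v m (x p, fst p))"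
    using i by (subst sum.insert, simp, simp, subst prod.remove[of _ "(A, i)"])
      (auto simp: labels_def intro!: prod.cong)
  also have "(1 - l) ^ m * \<dots> = pot v m (placed k x)"
  proof -
    have "mset_set (labels k) = add_mset (A, i) (mset_set (labels k - {(A, i)}))"
      using i by (subst mset_set.remove[of _ "(A, i)"]) (auto simp: labels_def)
    then have "placed k x = add_mset (v, A) (image_mset (\<lambda>p. (x p, fst p)) (mset_set (labels k - {(A, i)})))"
      using i by (simp add: placed_def)
    then show ?thesis
      by (simp add: pot_add_self multiset.map_comp o_def prod_unfold_prod_mset)
  qed
  finally show ?thesis by simp
qed

text \<open>By \<open>sum_hit_starts\<close> and Bernoulli's inequality, a uniform location loses at
  most \<open>e B * (1 + l * m) / card V\<close> of the weight on average.\<close>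

lemma expectation_wt_ge:
  assumes "V \<noteq> {}" "e B * (1 + l * m) \<le> card V / 2"
  shows "exp (- 2 * (e B * (1 + l * m) / card V)) \<le> measure_pmf.expectation (pmf_of_set V) (\<lambda>x. wt v m (x, B))"
proof -
  have n: "0 < card V" using assms(1) finite_V by (simp add: card_gt_0_iff)
  have "exp (- 2 * (e B * (1 + l * m) / card V)) \<le> 1 - e B * (1 + l * m) / card V"
    using assms(2) n e_nonneg l by (intro exp_le_one_minus) (auto simp: field_simps)
  also have "\<dots> = (card V - e B * (1 + l * m)) / card V"
    using assms(1) by (simp add: diff_divide_distrib)
  also have "\<dots> \<le> (\<Sum>x\<in>V. wt v m (x, B)) / card V"
  proof (rule divide_right_mono)
    have "(\<Sum>x\<in>V. 1 - wt v m (x, B)) \<le> (\<Sum>x\<in>V. e B * hit G l v m x)"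
      using one_minus_wt_le[of v m "(x, B)" for x] by (intro sum_mono) simp
    also have "\<dots> \<le> e B * (1 + l * m)"
      unfolding sum_distrib_left[symmetric] by (intro mult_left_mono sum_hit_starts e_nonneg)
    finally show "card V - e B * (1 + l * m) \<le> (\<Sum>x\<in>V. wt v m (x, B))"
      by (simp add: sum_subtractf)
  qed simp
  also have "\<dots> = measure_pmf.expectation (pmf_of_set V) (\<lambda>x. wt v m (x, B))"
    using assms(1) finite_V by (simp add: integral_pmf_of_set)
  finally show ?thesis .
qed

text \<open>By independence, a summand of \<open>pot_placed_ge\<close> has a factor
  \<open>1 / card V\<close> for the particle at \<open>v\<close> and fewer than
  \<open>card V\<close> factors for the others. Summing over all \<open>v\<close> cancels the first
  factor.\<close>

lemma expectation_total_pot_ge: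
  fixes emax :: real
  assumes V: "V \<noteq> {}" and emax: "\<And>B. e B \<le> emax"
    and m: "emax * (1 + l * m) \<le> card V / 2" and k: "(\<Sum>B\<in>UNIV. k B) = card V" and l2: "l \<le> 1 / 2"
  shows "k A * exp (- 2 * (l * m) - 2 * (emax * (1 + l * m))) \<le>
    measure_pmf.expectation (Pi_pmf (labels k) undefined (\<lambda>_. pmf_of_set V)) (\<lambda>x. total_pot m (placed k x))"
proof -
  let ?\<mu> = "Pi_pmf (labels k) undefined (\<lambda>_. pmf_of_set V)"
  let ?f = "\<lambda>v i p y. if p = (A, i) then of_bool (y = v) else wt v m (y, fst p)"
  let ?n = "card V"
  define \<kappa> where "\<kappa> = exp (- 2 * (emax * (1 + l * m)))"
  have n: "0 < ?n" using V finite_V by (simp add: card_gt_0_iff)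
  have f_abs: "\<bar>?f v i p y\<bar> \<le> 1" for v i p y using wt_01[of v m "(y, fst p)"] by simp
  have prod_ge: "\<kappa> / ?n \<le> measure_pmf.expectation ?\<mu> (\<lambda>x. \<Prod>p\<in>labels k. ?f v i p (x p))"
    if v: "v \<in> V" and i: "i < k A" for v i
  proof -
    let ?L = "labels k - {(A, i)}"
    have mem: "(A, i) \<in> labels k" using i by (simp add: labels_def)
    have "measure_pmf.expectation ?\<mu> (\<lambda>x. \<Prod>p\<in>labels k. ?f v i p (x p)) =
        (\<Prod>p\<in>labels k. measure_pmf.expectation (pmf_of_set V) (?f v i p))"
    proof (rule expectation_prod_Pi_pmf)
      show "integrable (measure_pmf (pmf_of_set V)) (?f v i p)" for p
        by (rule integrable_pmf_bounded[OF f_abs])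
      show "0 \<le> ?f v i p y" for p y using wt_01 by simp
    qed simp
    also have "\<dots> = measure_pmf.expectation (pmf_of_set V) (?f v i (A, i)) *
        (\<Prod>p\<in>?L. measure_pmf.expectation (pmf_of_set V) (?f v i p))"
      using mem by (simp add: prod.remove)
    also have "measure_pmf.expectation (pmf_of_set V) (?f v i (A, i)) = 1 / ?n"
      using V finite_V v by (simp add: integral_pmf_of_set of_bool_def)
    also have "(\<Prod>p\<in>?L. measure_pmf.expectation (pmf_of_set V) (?f v i p)) =
        (\<Prod>p\<in>?L. measure_pmf.expectation (pmf_of_set V) (\<lambda>y. wt v m (y, fst p)))"
      by (intro prod.cong) auto
    finally have eq: "measure_pmf.expectation ?\<mu> (\<lambda>x. \<Prod>p\<in>labels k. ?f v i p (x p)) =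
        1 / ?n * (\<Prod>p\<in>?L. measure_pmf.expectation (pmf_of_set V) (\<lambda>y. wt v m (y, fst p)))" .
    have le: "e B * (1 + l * m) \<le> emax * (1 + l * m)" for B
      using emax l by (intro mult_right_mono) auto
    \<comment> \<open>\<open>\<kappa>\<close> is the product of \<open>card V\<close> copies of the
      bound for a single particle.\<close>
    have "\<kappa> \<le> exp (- 2 * (emax * (1 + l * m)) / ?n) ^ card ?L"
    proof -
      have "card ?L \<le> ?n" using k mem by (simp add: card_labels)
      moreover define a where "a = emax * (1 + l * m)"
      moreover have "0 \<le> a"
        using order_trans[OF e_nonneg emax[of A]] l by (simp add: a_def)
      ultimately have "card ?L * a \<le> ?n * a" by (intro mult_right_mono) auto
      then have "card ?L * (a / ?n) \<le> a" using n by (simp add: pos_divide_le_eq mult.commute)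
      moreover have "exp (- 2 * a / ?n) ^ card ?L = exp (- 2 * (card ?L * (a / ?n)))"
        by (simp add: exp_of_nat_mult[symmetric])
      ultimately show ?thesis unfolding \<kappa>_def a_def[symmetric] by simp
    qed
    also have "\<dots> = (\<Prod>p\<in>?L. exp (- 2 * (emax * (1 + l * m)) / ?n))" by simp
    also have "\<dots> \<le> (\<Prod>p\<in>?L. measure_pmf.expectation (pmf_of_set V) (\<lambda>y. wt v m (y, fst p)))"
    proof (rule prod_mono, intro conjI)
      fix p assume "p \<in> ?L"
      have "exp (- 2 * (emax * (1 + l * m)) / ?n) \<le> exp (- 2 * (e (fst p) * (1 + l * m) / ?n))"
        using le[of "fst p"] n by (simp add: divide_right_mono)
      also have "\<dots> \<le> measure_pmf.expectation (pmf_of_set V) (\<lambda>y. wt v m (y, fst p))"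
        using le[of "fst p"] m by (intro expectation_wt_ge V) simp
      finally show "exp (- 2 * (emax * (1 + l * m)) / ?n) \<le> measure_pmf.expectation (pmf_of_set V) (\<lambda>y. wt v m (y, fst p))" .
    qed simp
    finally show ?thesis unfolding eq using n by (simp add: divide_right_mono)
  qed
  have P01: "\<bar>\<Prod>p\<in>labels k. ?f v i p (x p)\<bar> \<le> 1" for v i x
    unfolding abs_prod by (intro prod_le_1 conjI f_abs abs_ge_zero)
  have "exp (- 2 * l) \<le> 1 - l" using l l2 by (intro exp_le_one_minus) auto
  then have "exp (- 2 * l) ^ m \<le> (1 - l) ^ m" by (intro power_mono) auto
  then have "exp (- 2 * (l * m)) \<le> (1 - l) ^ m" by (simp add: exp_of_nat_mult[symmetric] ac_simps)
  then have "exp (- 2 * (l * m)) * (k A * \<kappa>) \<le> (1 - l) ^ m * (k A * \<kappa>)"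
    by (intro mult_right_mono) (auto simp: \<kappa>_def)
  also have "\<dots> = (\<Sum>v\<in>V. (1 - l) ^ m * (\<Sum>i<k A. \<kappa> / ?n))"
    using V by simp
  also have "\<dots> \<le> (\<Sum>v\<in>V. (1 - l) ^ m * (\<Sum>i<k A. measure_pmf.expectation ?\<mu> (\<lambda>x. \<Prod>p\<in>labels k. ?f v i p (x p))))"
    using l_power_01 by (intro sum_mono mult_left_mono prod_ge) auto
  also have "\<dots> = (\<Sum>v\<in>V. measure_pmf.expectation ?\<mu> (\<lambda>x. (1 - l) ^ m * (\<Sum>i<k A. \<Prod>p\<in>labels k. ?f v i p (x p))))"
    unfolding Bochner_Integration.integral_mult_right_zero
    by (intro sum.cong arg_cong[where f = "(*) ((1 - l) ^ m)"] refl
        Bochner_Integration.integral_sum[symmetric] integrable_pmf_bounded[OF P01])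
  also have "\<dots> \<le> (\<Sum>v\<in>V. measure_pmf.expectation ?\<mu> (\<lambda>x. pot v m (placed k x)))"
    by (intro sum_mono integral_mono integrable_pmf_bounded[OF abs_pot_le] pot_placed_ge
        integrable_mult_right Bochner_Integration.integrable_sum integrable_pmf_bounded[OF P01])
  also have "\<dots> = measure_pmf.expectation ?\<mu> (\<lambda>x. total_pot m (placed k x))"
    unfolding total_pot_def
    by (intro Bochner_Integration.integral_sum[symmetric] integrable_pmf_bounded[OF abs_pot_le])
  finally have "exp (- 2 * (l * m)) * (k A * \<kappa>) \<le> measure_pmf.expectation ?\<mu> (\<lambda>x. total_pot m (placed k x))" .
  moreover have "- 2 * (l * m) - 2 * (emax * (1 + l * m)) = - 2 * (l * m) + - 2 * (emax * (1 + l * m))"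
    by simp
  ultimately show ?thesis by (simp only: \<kappa>_def exp_add mult.left_commute)
qed

text \<open>\<open>fail_prob_le\<close> is averaged over the start. Exposing the
  \<open>card V\<close> locations and taking \<open>m\<close> lazy steps each contribute
  \<open>b^2\<close> to the second moment; the choice of \<open>l\<close> gives
  \<open>l * total_energy \<le> 1\<close>.\<close>

lemma prob_eliminated_le:
  fixes emax p \<theta> :: real
  assumes speed: "\<And>B. speed B = s" "0 < s" and emax: "\<And>B. e B \<le> emax"
    and V: "V \<noteq> {}" and k: "(\<Sum>B\<in>UNIV. k B) = card V"
    and l_eq: "l = 1 / (emax * card V)" and l2: "l \<le> 1 / 2"
    and m: "emax * (1 + l * m) \<le> card V / 2"
    and persist: "\<And>M. (mean_field_step react)\<^sup>*\<^sup>* (\<Sum>B\<in>UNIV. replicate_mset (k B) B) M \<Longrightarrow>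
      M \<noteq> {#} \<and> 2 * p \<le> l * size M"
    and p: "0 \<le> p" and \<theta>: "0 < \<theta>" "\<theta> \<le> k A * exp (- 2 * (l * m) - 2 * (emax * (1 + l * m)))"
    and b: "b = 4 * emax * (1 + l * m)"
  shows "measure_pmf.prob (run_system G speed react k T) {cs. \<not> not_yet_eliminated A cs} \<le>
    2 ^ T * (1 - p / 2) ^ m + (real (card V) + real m) * b\<^sup>2 / \<theta>\<^sup>2"
proof -
  let ?\<mu> = "Pi_pmf (labels k) undefined (\<lambda>_. pmf_of_set V)"
  let ?D = "\<lambda>x. (max 0 (\<theta> - total_pot m (placed k x)))\<^sup>2"
  let ?B = "\<lambda>x. 2 ^ T * (1 - p / 2) ^ m + (?D x + real m * b\<^sup>2) / \<theta>\<^sup>2"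
  have n: "0 < card V" using V finite_V by (simp add: card_gt_0_iff)
  have emax_pos: "0 < emax" using e_ge_1[of A] emax[of A] by simp
  have D_bdd: "\<bar>?D x\<bar> \<le> \<theta>\<^sup>2" for x
    using total_pot_bounds[of m "placed k x"] \<theta> by (auto intro!: power_mono)
  have energy: "l * total_energy (placed k x) \<le> 1" for x :: "'t \<times> nat \<Rightarrow> 'v"
    using total_energy_placed_le[OF emax, of k x] n emax_pos by (simp add: l_eq k field_simps)
  have fail: "fail_prob G speed react A T (placed k x) \<le> ?B x" for x
  proof (rule fail_prob_le[OF speed emax energy _ p \<theta>(1) b])
    fix M assume "(mean_field_step react)\<^sup>*\<^sup>* (image_mset snd (placed k x)) M"
    then show "M \<noteq> {#} \<and> 2 * p \<le> l * size M"
      by (intro persist) (simp add: image_snd_placed)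
  qed auto
  have int: "integrable (measure_pmf ?\<mu>) ?D"
    by (rule integrable_pmf_bounded[OF D_bdd])
  have "measure_pmf.prob (run_system G speed react k T) {cs. \<not> not_yet_eliminated A cs} =
      measure_pmf.expectation ?\<mu> (\<lambda>x. fail_prob G speed react A T (placed k x))"
    by (simp add: run_system_def uniform_start_eq prob_bind_pmf fail_prob_def)
  also have "\<dots> \<le> measure_pmf.expectation ?\<mu> ?B"
  proof (rule integral_mono)
    show "integrable (measure_pmf ?\<mu>) (\<lambda>x. fail_prob G speed react A T (placed k x))"
      using fail_prob_bounds[of G speed react A T] by (intro integrable_pmf_bounded[where B = 1]) auto
    show "integrable (measure_pmf ?\<mu>) ?B" using int by simp
  qed (rule fail)
  also have "\<dots> = 2 ^ T * (1 - p / 2) ^ m + (measure_pmf.expectation ?\<mu> ?D + real m * b\<^sup>2) / \<theta>\<^sup>2"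
    using int by simp
  also have "measure_pmf.expectation ?\<mu> ?D \<le>
      (max 0 (\<theta> - measure_pmf.expectation ?\<mu> (\<lambda>x. total_pot m (placed k x))))\<^sup>2 + real (card (labels k)) * b\<^sup>2"
    unfolding b
    by (rule Pi_pmf_pos_part_square_le[where f = "\<lambda>x. total_pot m (placed k x)",
          OF finite_labels abs_total_pot_le abs_total_pot_placed_diff_le[OF emax]])
  \<comment> \<open>\<open>\<theta>\<close> is at most the mean initial potential, so only
    fluctuations remain.\<close>
  also have "\<theta> - measure_pmf.expectation ?\<mu> (\<lambda>x. total_pot m (placed k x)) \<le> 0"
    using expectation_total_pot_ge[OF V emax m k l2] \<theta> by simp
  then have "max 0 (\<theta> - measure_pmf.expectation ?\<mu> (\<lambda>x. total_pot m (placed k x))) = 0"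
    by simp
  finally show ?thesis
    by (simp add: card_labels k divide_right_mono distrib_right)
qed

end

section \<open>Asymptotics\<close>

lemma dissipative_energy:
  fixes react :: "'t::finite \<Rightarrow> 't \<Rightarrow> 't multiset pmf"
  assumes "dissipative react"
  obtains e :: "'t \<Rightarrow> real" and emax where "\<And>B. 1 \<le> e B" "\<And>B. e B \<le> emax"
    "\<And>B C S. S \<in> set_pmf (react B C) \<Longrightarrow> (\<Sum>D\<in>#S. e D) \<le> e B + e C"
proof -
  obtain energy :: "'t \<Rightarrow> real" where pos: "\<And>B. 0 < energy B"
    and dec: "\<And>B C S. S \<in> set_pmf (react B C) \<Longrightarrow> S \<noteq> {#B, C#} \<Longrightarrow>
      (\<Sum>D\<in>#S. energy D) < energy B + energy C"
    using assms unfolding dissipative_def by blast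
  define r where "r = Min (range energy)"
  have r: "0 < r" "\<And>B. r \<le> energy B" using pos by (auto simp: r_def)
  show thesis
  proof
    show "1 \<le> energy B / r" for B using r by simp
    show "energy B / r \<le> Max (range (\<lambda>B. energy B / r))" for B by (rule Max_ge) auto
    fix B C S assume S: "S \<in> set_pmf (react B C)"
    have "(\<Sum>D\<in>#S. energy D) \<le> energy B + energy C"
      using dec[OF S] by (cases "S = {#B, C#}") auto
    moreover have "(\<Sum>D\<in>#S. energy D / r) = (\<Sum>D\<in>#S. energy D) / r"
      by (induction S) (auto simp: add_divide_distrib)
    ultimately show "(\<Sum>D\<in>#S. energy D / r) \<le> energy B / r + energy C / r"
      using r by (simp add: divide_right_mono flip: add_divide_distrib)
  qed
qed

text \<open>The second summand is of order \<open>(ln n)^3 / sqrt n\<close>: the exponent 3/4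
  exceeds 1/2, so the squared mean outgrows the accumulated variance.\<close>

lemma failure_bound_tendsto_0:
  fixes c \<delta> a :: real
  assumes "0 < c" "0 < \<delta>" "0 < a"
  shows "(\<lambda>n. (1 / 2) ^ nat \<lfloor>\<delta> * real n * ln (real n)\<rfloor> +
    (real n + a * real n * ln (real n)) * (4 * a * (1 + ln (real n)))\<^sup>2 / (c * real n powr (3 / 4))\<^sup>2)
    \<longlonglongrightarrow> 0"
proof -
  have "filterlim (\<lambda>n. \<delta> * real n * ln (real n)) at_top sequentially"
    using assms by real_asymp
  then have "filterlim (\<lambda>n. nat \<lfloor>\<delta> * real n * ln (real n)\<rfloor>) at_top sequentially"
    by (intro filterlim_compose[OF filterlim_nat_sequentially] filterlim_compose[OF filterlim_floor_sequentially])
  then have "(\<lambda>n. (1 / 2 :: real) ^ nat \<lfloor>\<delta> * real n * ln (real n)\<rfloor>) \<longlonglongrightarrow> 0"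
    by (rule filterlim_compose[OF LIMSEQ_power_zero, rotated]) simp
  moreover have "(\<lambda>n. (real n + a * real n * ln (real n)) * (4 * a * (1 + ln (real n)))\<^sup>2 / (c * real n powr (3 / 4))\<^sup>2)
    \<longlonglongrightarrow> 0"
    using assms by real_asymp
  ultimately show ?thesis by (rule tendsto_add_zero)
qed

text \<open>\<open>\<delta>\<close> is chosen so that \<open>l * m\<close> is at most
  \<open>ln n / (8 * emax + 8)\<close> when \<open>m\<close> is \<open>R\<close> times the number of
  steps; the expected initial potential then loses a factor of at most \<open>n powr (1 / 4)\<close>
  up to constants.\<close>

lemma eventually_prob_eliminated_le:
  fixes react :: "'t::finite \<Rightarrow> 't \<Rightarrow> 't multiset pmf" and e :: "'t \<Rightarrow> real" and emax \<epsilon> p \<delta> \<eta> :: real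
  assumes e: "\<And>B. 1 \<le> e B" "\<And>B. e B \<le> emax"
    "\<And>B C S. S \<in> set_pmf (react B C) \<Longrightarrow> (\<Sum>D\<in>#S. e D) \<le> e B + e C"
    and speed: "\<And>B. speed B = s" "0 < s"
    and k: "\<And>n. (\<Sum>B\<in>UNIV. k n B) = n"
    and persist: "0 < \<epsilon>" "\<forall>\<^sub>F n in sequentially. \<forall>M.
        (mean_field_step react)\<^sup>*\<^sup>* (\<Sum>B\<in>UNIV. replicate_mset (k n B) B) M \<longrightarrow> real (size M) / real n \<ge> \<epsilon>"
    and p: "0 < p" "p \<le> 1" "2 * p * emax \<le> \<epsilon>" and R: "(1 - p / 2) ^ R \<le> 1 / 4" "0 < R"
    and \<delta>: "\<delta> = emax / (R * (8 * emax + 8))"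
    and A: "positive_initial_density k A" and \<eta>: "0 < \<eta>"
  shows "\<forall>\<^sub>F n in sequentially. \<forall>G :: 'v pair_pre_digraph. regular_graph G \<and> card (pverts G) = n \<longrightarrow>
    measure_pmf.prob (run_system G speed react (k n) (nat \<lfloor>\<delta> * real n * ln (real n)\<rfloor>))
      {cs. \<not> not_yet_eliminated A cs} \<le> \<eta>"
proof -
  obtain c where c: "0 < c" "\<forall>\<^sub>F n in sequentially. real (k n A) / real n \<ge> c"
    using A by (auto simp: positive_initial_density_def)
  have emax: "1 \<le> emax" using e(1)[of A] e(2)[of A] by simp
  have \<delta>_pos: "0 < \<delta>" using emax R by (simp add: \<delta>)
  define c' where "c' = c * exp (- 2 * emax)"
  have c': "0 < c'" using c by (simp add: c'_def)
  define bound where "bound n = (1 / 2) ^ nat \<lfloor>\<delta> * real n * ln (real n)\<rfloor> +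
    (real n + emax * real n * ln (real n)) * (4 * emax * (1 + ln (real n)))\<^sup>2 / (c' * real n powr (3 / 4))\<^sup>2" for n
  have "bound \<longlonglongrightarrow> 0"
    unfolding bound_def using emax by (intro failure_bound_tendsto_0 c' \<delta>_pos) simp
  then have ev_bound: "\<forall>\<^sub>F n in sequentially. bound n < \<eta>"
    using \<eta> by (rule order_tendstoD)
  \<comment> \<open>Gives \<open>emax * (1 + l * m) \<le> n / 2\<close>, since
    \<open>emax * (l * m)\<close> is at most \<open>ln n\<close>.\<close>
  have ev_ln: "\<forall>\<^sub>F n in sequentially. emax + ln (real n) \<le> real n / 2"
    using emax by real_asymp
  show ?thesis
    using c(2) persist(2) ev_bound ev_ln eventually_ge_at_top[of 2]
  proof eventually_elim
    case (elim n)
    define T where "T = nat \<lfloor>\<delta> * real n * ln (real n)\<rfloor>"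
    \<comment> \<open>With \<open>R\<close> lazy steps per genuine step,
      \<open>(1 - p / 2) ^ R \<le> 1 / 4\<close> outweighs the 2 in \<open>2 ^ T\<close>.\<close>
    define m where "m = R * T"
    \<comment> \<open>The largest \<open>l\<close> for which \<open>l\<close> times the energy bound
      \<open>emax * n\<close> is at most 1.\<close>
    define l where "l = 1 / (emax * n)"
    define \<theta> where "\<theta> = c' * real n powr (3 / 4)"
    have n: "2 \<le> n" and ln_nonneg: "0 \<le> ln (real n)" using elim by auto
    have l_bounds: "0 < l" "l \<le> 1 / 2"
      using n emax mult_mono[of 1 emax 2 "real n"] by (auto simp: l_def field_simps)
    have "real T \<le> \<delta> * n * ln n"
      using \<delta>_pos ln_nonneg unfolding T_def by (intro of_nat_floor) simp
    then have "real m \<le> R * (\<delta> * n * ln n)"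
      by (simp add: m_def mult_left_mono)
    also have "\<dots> = emax / (8 * emax + 8) * (n * ln n)"
      using R emax by (simp add: \<delta>)
    finally have m: "real m \<le> emax / (8 * emax + 8) * (n * ln n)" .
    have "l * m \<le> l * (emax / (8 * emax + 8) * (n * ln n))"
      using m l_bounds by (intro mult_left_mono) auto
    also have "\<dots> = ln n / (8 * emax + 8)"
      using n emax by (simp add: l_def)
    finally have lm: "l * m \<le> ln n / (8 * emax + 8)" .
    have lm': "8 * (emax * (l * m)) + 8 * (l * m) \<le> ln n"
      using lm emax by (simp add: pos_le_divide_eq algebra_simps)
    have lm_nonneg: "0 \<le> l * m" using l_bounds by simp
    then have "0 \<le> emax * (l * m)" using emax by simp
    then have lm_ln: "l * m \<le> ln n" "emax * (l * m) \<le> ln n"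
      using lm' lm_nonneg by linarith+
    have m_le: "real m \<le> emax * n * ln n"
    proof -
      have "emax / (8 * emax + 8) \<le> emax / 1" using emax by (intro divide_left_mono) auto
      then have "emax / (8 * emax + 8) * (n * ln n) \<le> emax * (n * ln n)"
        using ln_nonneg by (intro mult_right_mono) auto
      then show ?thesis using m by (simp add: mult.assoc)
    qed
    have \<theta>: "0 < \<theta>" using c' n by (simp add: \<theta>_def)
    have kA: "c * n \<le> k n A"
      using elim(1) n by (simp add: pos_le_divide_eq)
    have "\<theta> = c * n * exp (- 2 * emax - ln n / 4)"
    proof -
      have "real n * exp (- (ln n / 4)) = exp (ln n) * exp (- (ln n / 4))" using n by simp
      also have "\<dots> = exp (ln n - ln n / 4)" by (simp only: exp_add[symmetric] diff_conv_add_uminus)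
      also have "\<dots> = real n powr (3 / 4)" using n by (simp add: powr_def)
      finally have "real n powr (3 / 4) = real n * exp (- (ln n / 4))" ..
      moreover have "exp (- 2 * emax - ln n / 4) = exp (- 2 * emax) * exp (- (ln n / 4))"
        by (simp only: exp_add[symmetric] diff_conv_add_uminus)
      ultimately show ?thesis by (simp add: \<theta>_def c'_def)
    qed
    also have "\<dots> \<le> k n A * exp (- 2 * (l * m) - 2 * (emax * (1 + l * m)))"
    proof (rule mult_mono[OF kA])
      show "exp (- 2 * emax - ln n / 4) \<le> exp (- 2 * (l * m) - 2 * (emax * (1 + l * m)))"
        using lm' by (simp add: algebra_simps)
    qed auto
    finally have \<theta>_le: "\<theta> \<le> \<dots>" .
    show ?case
    proof (intro allI impI, elim conjE)
      fix G :: "'v pair_pre_digraph"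
      assume G: "regular_graph G" and cardG: "card (pverts G) = n"
      interpret energy_walk G l react e A
        by unfold_locales (use G l_bounds e in auto)
      have "measure_pmf.prob (run_system G speed react (k n) T) {cs. \<not> not_yet_eliminated A cs} \<le>
          2 ^ T * (1 - p / 2) ^ m + (real (card (pverts G)) + real m) * (4 * emax * (1 + l * m))\<^sup>2 / \<theta>\<^sup>2"
      proof (rule prob_eliminated_le[where k = "k n" and emax = emax and p = p,
            OF speed e(2) _ _ _ l_bounds(2) _ _ _ \<theta> \<theta>_le refl])
        show "pverts G \<noteq> {}" using cardG n by auto
        show "(\<Sum>B\<in>UNIV. k n B) = card (pverts G)" using k cardG by simp
        show "l = 1 / (emax * card (pverts G))" by (simp add: l_def cardG)
        show "emax * (1 + l * m) \<le> card (pverts G) / 2"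
          using lm_ln elim(4) by (simp add: cardG distrib_left)
        show "0 \<le> p" using p by simp
        fix M assume "(mean_field_step react)\<^sup>*\<^sup>* (\<Sum>B\<in>UNIV. replicate_mset (k n B) B) M"
        then have M: "\<epsilon> \<le> real (size M) / real n" using elim(2) by blast
        then have "2 * p \<le> real (size M) / real n / emax"
          using p emax by (subst pos_le_divide_eq) auto
        moreover have "M \<noteq> {#}" using M persist(1) by auto
        ultimately show "M \<noteq> {#} \<and> 2 * p \<le> l * size M" by (simp add: l_def mult.commute)
      qed
      also have "\<dots> \<le> bound n"
        unfolding bound_def T_def[symmetric] \<theta>_def[symmetric]
      proof (rule add_mono)
        have "2 ^ T * (1 - p / 2) ^ m = 2 ^ T * ((1 - p / 2) ^ R) ^ T"
          by (simp add: m_def power_mult)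
        also have "\<dots> \<le> 2 ^ T * (1 / 4) ^ T"
          using R p by (intro mult_left_mono power_mono) auto
        also have "\<dots> = (2 * (1 / 4)) ^ T" by (rule power_mult_distrib[symmetric])
        also have "\<dots> = (1 / 2) ^ T" by simp
        finally show "2 ^ T * (1 - p / 2) ^ m \<le> (1 / 2) ^ T" .
        have "real (card (pverts G)) + real m \<le> real n + emax * real n * ln (real n)"
          using m_le by (simp add: cardG)
        moreover have "(4 * emax * (1 + l * m))\<^sup>2 \<le> (4 * emax * (1 + ln (real n)))\<^sup>2"
          using lm_ln(1) lm_nonneg emax by (intro power_mono mult_left_mono add_left_mono) auto
        ultimately show "(real (card (pverts G)) + real m) * (4 * emax * (1 + l * m))\<^sup>2 / \<theta>\<^sup>2 \<le>
            (real n + emax * real n * ln (real n)) * (4 * emax * (1 + ln (real n)))\<^sup>2 / \<theta>\<^sup>2"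
          by (intro divide_right_mono mult_mono') auto
      qed
      also have "\<dots> \<le> \<eta>" using elim(3) by simp
      finally show "measure_pmf.prob (run_system G speed react (k n) (nat \<lfloor>\<delta> * real n * ln (real n)\<rfloor>))
        {cs. \<not> not_yet_eliminated A cs} \<le> \<eta>"
        by (simp add: T_def)
    qed
  qed
qed

section \<open>Choice of constants and union bound over the types\<close>

theorem corollary1p6:
  fixes speed :: "'t::finite \<Rightarrow> real"
    and react :: "'t \<Rightarrow> 't \<Rightarrow> 't multiset pmf"
    and k :: "nat \<Rightarrow> 't \<Rightarrow> nat"
  assumes "particle_system speed react"
    and "dissipative react"
    and "\<And>n. (\<Sum>A\<in>UNIV. k n A) = n"
    and "persistent react k"
    and "\<And>A B. speed A = speed B"
  shows "\<exists>\<delta>>0. \<forall>\<eta>>0. \<forall>\<^sub>F n in sequentially. \<forall>G :: 'v pair_pre_digraph.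
           regular_graph G \<and> card (pverts G) = n \<longrightarrow>
           measure_pmf.prob (run_system G speed react (k n) (nat \<lfloor>\<delta> * real n * ln (real n)\<rfloor>))
             {cs. \<forall>A. positive_initial_density k A \<longrightarrow> not_yet_eliminated A cs} \<ge> 1 - \<eta>"
proof -
  define s where "s = speed undefined"
  have speed: "\<And>B. speed B = s" unfolding s_def by (rule assms(5))
  have "0 \<le> s" "(\<Sum>B\<in>(UNIV :: 't set). s) = 1"
    using assms(1) speed by (auto simp: particle_system_def)
  then have s: "0 < s" by (cases "s = 0") auto
  obtain e :: "'t \<Rightarrow> real" and emax where e: "\<And>B. 1 \<le> e B" "\<And>B. e B \<le> emax"
    "\<And>B C S. S \<in> set_pmf (react B C) \<Longrightarrow> (\<Sum>D\<in>#S. e D) \<le> e B + e C"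
    using dissipative_energy[OF assms(2)] by blast
  obtain \<epsilon> where persist: "0 < \<epsilon>" "\<forall>\<^sub>F n in sequentially. \<forall>M.
      (mean_field_step react)\<^sup>*\<^sup>* (\<Sum>B\<in>UNIV. replicate_mset (k n B) B) M \<longrightarrow> real (size M) / real n \<ge> \<epsilon>"
    using assms(4) by (auto simp: persistent_def)
  have emax: "1 \<le> emax" using e(1)[of undefined] e(2)[of undefined] by simp
  \<comment> \<open>The cap 1 keeps \<open>1 - p / 2\<close> in the unit interval; the other bound
    turns density \<open>\<epsilon>\<close> into \<open>2 * p \<le> l * size M\<close> for
    \<open>l = 1 / (emax * n)\<close>.\<close>
  define p where "p = min 1 (\<epsilon> / (2 * emax))"
  have "p \<le> \<epsilon> / (2 * emax)" by (simp add: p_def)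
  then have "p * (2 * emax) \<le> \<epsilon>" using emax by (subst (asm) pos_le_divide_eq) auto
  then have p: "0 < p" "p \<le> 1" "2 * p * emax \<le> \<epsilon>"
    using emax persist(1) by (auto simp: p_def ac_simps)
  obtain R where R: "(1 - p / 2) ^ R < 1 / 4"
    using real_arch_pow_inv[of "1 / 4" "1 - p / 2"] p by auto
  then have R': "0 < R" by (cases R) auto
  \<comment> \<open>\<open>emax\<close> and \<open>R\<close> come from the energies and the
    persistence constant, so \<open>\<delta>\<close> is the same for all graphs, all
    \<open>\<eta>\<close> and all types.\<close>
  define \<delta> where "\<delta> = emax / (R * (8 * emax + 8))"
  have "0 < \<delta>" using emax R' by (simp add: \<delta>_def)
  moreover have "\<forall>\<^sub>F n in sequentially. \<forall>G :: 'v pair_pre_digraph.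
           regular_graph G \<and> card (pverts G) = n \<longrightarrow>
           measure_pmf.prob (run_system G speed react (k n) (nat \<lfloor>\<delta> * real n * ln (real n)\<rfloor>))
             {cs. \<forall>A. positive_initial_density k A \<longrightarrow> not_yet_eliminated A cs} \<ge> 1 - \<eta>"
    if \<eta>: "0 < \<eta>" for \<eta>
  proof -
    \<comment> \<open>Each type of positive initial density is allotted failure probability
      \<open>\<eta> / ?N\<close>.\<close>
    let ?\<D> = "{A. positive_initial_density k A}"
    let ?N = "real CARD('t)"
    let ?prob = "\<lambda>G n. measure_pmf.prob
      (run_system G speed react (k n) (nat \<lfloor>\<delta> * real n * ln (real n)\<rfloor>) :: ('v, 't) config list pmf)"
    have "\<forall>\<^sub>F n in sequentially. \<forall>G :: 'v pair_pre_digraph.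
        regular_graph G \<and> card (pverts G) = n \<longrightarrow> ?prob G n {cs. \<not> not_yet_eliminated A cs} \<le> \<eta> / ?N"
      if "A \<in> ?\<D>" for A
    proof (rule eventually_prob_eliminated_le[OF e speed s assms(3) persist p _ R' \<delta>_def])
      show "(1 - p / 2) ^ R \<le> 1 / 4" using R by simp
      show "positive_initial_density k A" using that by simp
      show "0 < \<eta> / ?N" using \<eta> by simp
    qed
    then have "\<forall>\<^sub>F n in sequentially. \<forall>A\<in>?\<D>. \<forall>G :: 'v pair_pre_digraph.
        regular_graph G \<and> card (pverts G) = n \<longrightarrow> ?prob G n {cs. \<not> not_yet_eliminated A cs} \<le> \<eta> / ?N"
      by (intro eventually_ball_finite) auto
    then show ?thesis
    proof eventually_elim
      case (elim n)
      show ?case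
      proof (intro allI impI)
        fix G :: "'v pair_pre_digraph" assume G: "regular_graph G \<and> card (pverts G) = n"
        let ?good = "{cs :: ('v, 't) config list. \<forall>A. positive_initial_density k A \<longrightarrow> not_yet_eliminated A cs}"
        have "?prob G n (- ?good) = ?prob G n (\<Union>A\<in>?\<D>. {cs. \<not> not_yet_eliminated A cs})"
          by (rule arg_cong[where f = "?prob G n"]) auto
        also have "\<dots> \<le> (\<Sum>A\<in>?\<D>. ?prob G n {cs. \<not> not_yet_eliminated A cs})"
          by (intro measure_pmf.finite_measure_subadditive_finite) auto
        also have "\<dots> \<le> (\<Sum>A\<in>?\<D>. \<eta> / ?N)"
          using elim G by (intro sum_mono) auto
        also have "\<dots> \<le> ?N * (\<eta> / ?N)"
          using \<eta> by (simp only: sum_constant) (intro mult_right_mono, auto intro: card_mono)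
        also have "\<dots> = \<eta>" by simp
        finally have "?prob G n (- ?good) \<le> \<eta>" .
        moreover have "?prob G n (- ?good) = 1 - ?prob G n ?good"
          by (subst measure_pmf.prob_compl[symmetric]) (auto simp: Compl_eq_Diff_UNIV)
        ultimately show "1 - \<eta> \<le> ?prob G n ?good" by simp
      qed
    qed
  qed
  ultimately show ?thesis by blast
qed

end
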